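(* Let $\mathfrak{F}=\{f\in B(\mathcal X):\|f\|_\infty\le1\}$. The following are equivalent: (i) there exists a unique invariant probability measure $\mu$ for $\Phi$ such that $\lim_{t\to\infty}\|P_t^*\nu-\mu\|_{TV}=0$ for every $\nu\in\mathcal P(\mathcal X)$; (ii) $\Phi$ is uniformly eventually continuous with respect to $\mathfrak F$ on $\mathcal X$ and there exists $z\in\mathcal X$ such that $\Phi$ satisfies $(\mathcal C_1)$ at $z$; (iii) there exists $z\in\mathcal X$ such that $\Phi$ is uniformly eventually continuous with respect to $\mathfrak F$ at $z$ and satisfies $(\mathcal C_1)$ at $z$.
   Context: Standing setting: $(\mathcal{X},\rho)$ is a Polish space; $\Phi=\{\Phi_t\}_{t\ge0}$ is a càdlàg Feller Markov process on $\mathcal{X}$ with transition kernels $P_t(x,\cdot)$; $P_tf(x)=\int f\,dP_t(x,\cdot)$ for bounded Borel $f$; $P_t^*\nu(A)=\int P_t(x,A)\nu(dx)$. $B(\mathcal X)$ is the set of Borel real functions, $\mathcal P(\mathcal X)$ the Borel probability measures, $B(z,r)$ the open ball. $\|\mu-\nu\|_{TV}=\sup_{\|f\|_\infty\le1}|\int f\,d\mu-\int f\,d\nu|$. $(\mathcal C_1)$ at $z$: for every $r>0$, $\inf_{x\in\mathcal X}\liminf_{t\to\infty}P_t(x,B(z,r))>0$. $\Phi$ is uniformly eventually continuous with respect to $\mathfrak F$ at $x$ if $\limsup_{x'\to x}\limsup_{t\to\infty}\sup_{f\in\mathfrak F}|P_tf(x')-P_tf(x)|=0$; "on $\mathcal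 X$" means at every point. *)

theory Defs
  imports "HOL-Probability.Probability"
begin

definition trans_op :: "(real \<Rightarrow> 'a \<Rightarrow> 'a measure) \<Rightarrow> real \<Rightarrow> ('a \<Rightarrow> real) \<Rightarrow> 'a \<Rightarrow> real" where
  "trans_op P t f x = (\<integral>y. f y \<partial>(P t x))"

definition kpush :: "(real \<Rightarrow> 'a \<Rightarrow> 'a measure) \<Rightarrow> real \<Rightarrow> 'a measure \<Rightarrow> 'a measure" where
  "kpush P t \<nu> = (\<nu> \<bind> P t)"

definition unit_ball_fns :: "('a::topological_space \<Rightarrow> real) set" where
  "unit_ball_fns = {f. f \<in> borel_measurable borel \<and> (\<forall>x. \<bar>f x\<bar> \<le> 1)}"

definition tv_dist :: "'a::topological_space measure \<Rightarrow> 'a measure \<Rightarrow> real" where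
  "tv_dist \<mu> \<nu> = (SUP f\<in>unit_ball_fns. \<bar>(\<integral>x. f x \<partial>\<mu>) - (\<integral>x. f x \<partial>\<nu>)\<bar>)"

definition prob_measure_on :: "'a::topological_space measure \<Rightarrow> bool" where
  "prob_measure_on \<nu> \<longleftrightarrow> \<nu> \<in> space (prob_algebra borel)"

text \<open>Feller Markov transition semigroup of a cadlag process (the properties used:
  Markov kernels, P_0 = identity, Chapman--Kolmogorov, Feller property, and
  right continuity of t \<mapsto> P_t f(x) for bounded continuous f, implied by cadlag paths).\<close>
definition feller_markov_semigroup :: "(real \<Rightarrow> 'a::metric_space \<Rightarrow> 'a measure) \<Rightarrow> bool" where
  "feller_markov_semigroup P \<longleftrightarrow>
     (\<forall>t\<ge>0. P t \<in> borel \<rightarrow>\<^sub>M prob_algebra borel) \<and>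
     (\<forall>x. P 0 x = return borel x) \<and>
     (\<forall>s\<ge>0. \<forall>t\<ge>0. \<forall>x. P (s + t) x = (P s x \<bind> P t)) \<and>
     (\<forall>t\<ge>0. \<forall>f. continuous_on UNIV f \<and> bounded (range f) \<longrightarrow>
          continuous_on UNIV (trans_op P t f)) \<and>
     (\<forall>f x. continuous_on UNIV f \<and> bounded (range f) \<longrightarrow>
          (\<forall>t\<ge>0. continuous (at_right t) (\<lambda>s. trans_op P s f x)))"

definition invariant_measure :: "(real \<Rightarrow> 'a::topological_space \<Rightarrow> 'a measure) \<Rightarrow> 'a measure \<Rightarrow> bool" where
  "invariant_measure P \<mu> \<longleftrightarrow> prob_measure_on \<mu> \<and> (\<forall>t\<ge>0. kpush P t \<mu> = \<mu>)"

text \<open>Uniform eventual continuity w.r.t. a class of functions F at x.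
  limsup_{x'\<rightarrow>x} is taken over the neighbourhood filter (x' = x contributes 0, so this
  agrees with the punctured version and is meaningful at isolated points).\<close>
definition uec_at :: "(real \<Rightarrow> 'a::topological_space \<Rightarrow> 'a measure) \<Rightarrow> ('a \<Rightarrow> real) set \<Rightarrow> 'a \<Rightarrow> bool" where
  "uec_at P F x \<longleftrightarrow>
     Limsup (nhds x) (\<lambda>x'. Limsup at_top (\<lambda>t. SUP f\<in>F. ereal \<bar>trans_op P t f x' - trans_op P t f x\<bar>)) = 0"

definition C1_at :: "(real \<Rightarrow> 'a::metric_space \<Rightarrow> 'a measure) \<Rightarrow> 'a \<Rightarrow> bool" where
  "C1_at P z \<longleftrightarrow>
     (\<forall>r>0. 0 < (INF x. Liminf at_top (\<lambda>t. ereal (measure (P t x) (ball z r)))))"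

end

theory Submission
  imports Defs
begin

text \<open>
  Suppose the process is uniformly eventually continuous at \<open>z\<close> and satisfies \<open>C1\<close> there. From any
  initial distribution a fixed fraction of the mass eventually sits in a small ball around \<open>z\<close>, and
  mass in that ball merges in total variation up to \<open>e\<close>. Splitting it off shows that the worst
  asymptotic distance \<open>S\<close> of two initial distributions satisfies \<open>S \<le> a * e + (1 - a) * S\<close>, so
  \<open>S = 0\<close>: any two initial distributions merge, though not uniformly.

  For the existence of an invariant measure, let \<open>Y\<close> be the closed set of points all of whose
  neighbourhoods keep being charged by \<open>P t z\<close>. By the Feller property \<open>P t z\<close> lives on \<open>Y\<close>, and \<open>Y\<close>
  is covered by the closed sets of points whose laws are, after time \<open>N\<close>, close to \<open>P N z\<close>. By Baire
  one of them contains a relatively open piece of \<open>Y\<close>, hence retains a fixed mass, which bounds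
  \<open>P n z\<close> from below by a multiple of \<open>P N z\<close> up to a small error. Therefore a finitely additive limit
  point of \<open>P n z\<close> has a nonzero countably additive part. Merging makes the limit point invariant, and
  with it its countably additive part, because that is the largest measure below it.
\<close>

section \<open>Total variation distance\<close>

lemma prob_measure_onD:
  assumes "prob_measure_on \<nu>"
  shows "prob_space \<nu>" "sets \<nu> = sets borel" "space \<nu> = UNIV"
  using assms sets_eq_imp_space_eq[of \<nu> borel]
  by (auto simp: prob_measure_on_def space_prob_algebra)

lemma prob_measure_onI: "prob_space \<nu> \<Longrightarrow> sets \<nu> = sets borel \<Longrightarrow> prob_measure_on \<nu>"
  by (simp add: prob_measure_on_def space_prob_algebra)

lemma prob_measure_on_return: "prob_measure_on (return borel x)"
  by (intro prob_measure_onI prob_space_return) auto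

lemma unit_ball_fnsD:
  assumes "f \<in> unit_ball_fns"
  shows "f \<in> borel_measurable borel" "\<bar>f x\<bar> \<le> 1"
  using assms by (auto simp: unit_ball_fns_def)

lemma zero_in_unit_ball_fns: "(\<lambda>_. 0) \<in> unit_ball_fns"
  by (simp add: unit_ball_fns_def)

lemma indicator_in_unit_ball_fns: "A \<in> sets borel \<Longrightarrow> indicator A \<in> unit_ball_fns"
  by (auto simp: unit_ball_fns_def indicator_def)

lemma continuous_in_unit_ball_fns:
  assumes "continuous_on UNIV f" "\<And>x. 0 \<le> f x" "\<And>x. f x \<le> 1"
  shows "f \<in> unit_ball_fns"
  using assms by (auto simp: unit_ball_fns_def borel_measurable_continuous_onI abs_of_nonneg)

lemma integrable_unit_ball_fns:
  assumes "prob_measure_on \<mu>" "f \<in> unit_ball_fns"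
  shows "integrable \<mu> f"
proof -
  interpret prob_space \<mu> using assms prob_measure_onD by blast
  have "f \<in> borel_measurable \<mu>"
    using assms unit_ball_fnsD(1) prob_measure_onD(2) by (metis measurable_cong_sets)
  then show ?thesis
    using assms by (intro integrable_const_bound[where B=1]) (auto dest: unit_ball_fnsD)
qed

lemma abs_integral_unit_ball_fns_le:
  assumes "prob_measure_on \<mu>" "f \<in> unit_ball_fns"
  shows "\<bar>\<integral>x. f x \<partial>\<mu>\<bar> \<le> 1"
proof -
  interpret prob_space \<mu> using assms prob_measure_onD by blast
  note int = integrable_unit_ball_fns[OF assms]
  have "f x \<le> 1" "-1 \<le> f x" for x
    using unit_ball_fnsD(2)[OF assms(2), of x] by auto
  then have "(\<integral>x. f x \<partial>\<mu>) \<le> 1" "-1 \<le> (\<integral>x. f x \<partial>\<mu>)"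
    using int by (auto intro!: integral_le_const integral_ge_const)
  then show ?thesis by simp
qed

lemma tv_dist_leI:
  assumes "\<And>f. f \<in> unit_ball_fns \<Longrightarrow> \<bar>(\<integral>x. f x \<partial>\<mu>) - (\<integral>x. f x \<partial>\<nu>)\<bar> \<le> c"
  shows "tv_dist \<mu> \<nu> \<le> c"
  unfolding tv_dist_def using zero_in_unit_ball_fns assms by (intro cSUP_least) auto

lemma diff_le_tv_dist:
  assumes "prob_measure_on \<mu>" "prob_measure_on \<nu>" "f \<in> unit_ball_fns"
  shows "\<bar>(\<integral>x. f x \<partial>\<mu>) - (\<integral>x. f x \<partial>\<nu>)\<bar> \<le> tv_dist \<mu> \<nu>"
  unfolding tv_dist_def
proof (rule cSUP_upper[OF assms(3)], rule bdd_aboveI2)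
  fix g :: "'a \<Rightarrow> real" assume "g \<in> unit_ball_fns"
  then show "\<bar>(\<integral>x. g x \<partial>\<mu>) - (\<integral>x. g x \<partial>\<nu>)\<bar> \<le> 2"
    using abs_integral_unit_ball_fns_le[OF assms(1), of g]
      abs_integral_unit_ball_fns_le[OF assms(2), of g] by auto
qed

lemma tv_dist_nonneg:
  assumes "prob_measure_on \<mu>" "prob_measure_on \<nu>"
  shows "0 \<le> tv_dist \<mu> \<nu>"
  using diff_le_tv_dist[OF assms zero_in_unit_ball_fns] by simp

lemma tv_dist_le_2:
  assumes "prob_measure_on \<mu>" "prob_measure_on \<nu>"
  shows "tv_dist \<mu> \<nu> \<le> 2"
proof (rule tv_dist_leI)
  fix g :: "'a \<Rightarrow> real" assume "g \<in> unit_ball_fns"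
  then show "\<bar>(\<integral>x. g x \<partial>\<mu>) - (\<integral>x. g x \<partial>\<nu>)\<bar> \<le> 2"
    using abs_integral_unit_ball_fns_le[OF assms(1), of g]
      abs_integral_unit_ball_fns_le[OF assms(2), of g] by auto
qed

lemma tv_dist_commute: "tv_dist \<mu> \<nu> = tv_dist \<nu> \<mu>"
  by (simp add: tv_dist_def abs_minus_commute)

lemma tv_dist_triangle:
  assumes "prob_measure_on \<mu>" "prob_measure_on \<nu>" "prob_measure_on \<kappa>"
  shows "tv_dist \<mu> \<kappa> \<le> tv_dist \<mu> \<nu> + tv_dist \<nu> \<kappa>"
proof (rule tv_dist_leI)
  fix f :: "'a \<Rightarrow> real" assume "f \<in> unit_ball_fns"
  then show "\<bar>(\<integral>x. f x \<partial>\<mu>) - (\<integral>x. f x \<partial>\<kappa>)\<bar> \<le> tv_dist \<mu> \<nu> + tv_dist \<nu> \<kappa>"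
    using diff_le_tv_dist[OF assms(1,2), of f] diff_le_tv_dist[OF assms(2,3), of f] by auto
qed

lemma measure_diff_le_tv_dist:
  assumes "prob_measure_on \<mu>" "prob_measure_on \<nu>" "A \<in> sets borel"
  shows "\<bar>measure \<mu> A - measure \<nu> A\<bar> \<le> tv_dist \<mu> \<nu>"
  using diff_le_tv_dist[OF assms(1,2) indicator_in_unit_ball_fns[OF assms(3)]]
    prob_measure_onD[OF assms(1)] prob_measure_onD[OF assms(2)] by simp

lemma prob_measure_on_eqI:
  assumes "prob_measure_on \<mu>" "prob_measure_on \<nu>"
    and "\<And>A. A \<in> sets borel \<Longrightarrow> measure \<mu> A = measure \<nu> A"
  shows "\<mu> = \<nu>"
proof (rule measure_eqI)
  note D = prob_measure_onD[OF assms(1)] prob_measure_onD[OF assms(2)]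
  show "sets \<mu> = sets \<nu>" using D by simp
  interpret \<mu>: prob_space \<mu> by fact
  interpret \<nu>: prob_space \<nu> by fact
  show "emeasure \<mu> A = emeasure \<nu> A" if "A \<in> sets \<mu>" for A
    using that assms(3) D by (simp add: \<mu>.emeasure_eq_measure \<nu>.emeasure_eq_measure)
qed

lemma tv_dist_eq_0D:
  assumes "prob_measure_on \<mu>" "prob_measure_on \<nu>" "tv_dist \<mu> \<nu> = 0"
  shows "\<mu> = \<nu>"
  by (rule prob_measure_on_eqI[OF assms(1,2)])
     (use measure_diff_le_tv_dist[OF assms(1,2)] assms(3) in force)

text \<open>Dominated convergence for the positive part of \<open>h n - e\<close>, which vanishes
  eventually at almost every point. The index from which the bound holds may depend on the point,
  and \<open>\<delta>\<close> pays for that.\<close>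

lemma (in prob_space) eventually_integral_le:
  fixes h :: "nat \<Rightarrow> 'a \<Rightarrow> real"
  assumes [measurable]: "\<And>n. h n \<in> borel_measurable M"
    and bound: "\<And>n x. \<bar>h n x\<bar> \<le> c"
    and ev: "AE x in M. \<forall>\<^sub>F n in sequentially. h n x \<le> e" and "\<delta> > 0"
  shows "\<forall>\<^sub>F n in sequentially. (\<integral>x. h n x \<partial>M) \<le> e + \<delta>"
proof -
  let ?g = "\<lambda>n x. max 0 (h n x - e)"
  have int_h: "integrable M (h n)" for n
    using bound by (intro integrable_const_bound[where B=c]) auto
  have "(\<lambda>n. \<integral>x. ?g n x \<partial>M) \<longlonglongrightarrow> (\<integral>x. 0 \<partial>M)"
  proof (rule integral_dominated_convergence[where w="\<lambda>_. c + \<bar>e\<bar>"])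
    show "AE x in M. (\<lambda>n. ?g n x) \<longlonglongrightarrow> 0"
      using ev
    proof eventually_elim
      case (elim x)
      then have "\<forall>\<^sub>F n in sequentially. ?g n x = 0" by eventually_elim auto
      then show ?case by (rule tendsto_eventually)
    qed
    have "norm (?g n x) \<le> c + \<bar>e\<bar>" for n x
      using bound[of n x] by auto
    then show "AE x in M. norm (?g n x) \<le> c + \<bar>e\<bar>" for n by simp
  qed auto
  then have "\<forall>\<^sub>F n in sequentially. (\<integral>x. ?g n x \<partial>M) < \<delta>"
    using \<open>\<delta> > 0\<close> by (intro order_tendstoD(2)) auto
  then show ?thesis
  proof eventually_elim
    case (elim n)
    have "(\<integral>x. h n x \<partial>M) \<le> (\<integral>x. e + ?g n x \<partial>M)"
      using int_h by (intro integral_mono) auto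
    also have "\<dots> = e + (\<integral>x. ?g n x \<partial>M)"
      using int_h by (subst Bochner_Integration.integral_add) (auto simp: prob_space)
    finally show ?case using elim by simp
  qed
qed

section \<open>Transition operators\<close>

locale feller_semigroup =
  fixes P :: "real \<Rightarrow> 'a::polish_space \<Rightarrow> 'a measure"
  assumes feller: "feller_markov_semigroup P"
begin

lemma kernel: "t \<ge> 0 \<Longrightarrow> P t \<in> borel \<rightarrow>\<^sub>M prob_algebra borel"
  using feller by (simp add: feller_markov_semigroup_def)

lemma subkernel: "t \<ge> 0 \<Longrightarrow> P t \<in> borel \<rightarrow>\<^sub>M subprob_algebra borel"
  using kernel measurable_prob_algebraD by blast

lemma prob_measure_on_kernel: "t \<ge> 0 \<Longrightarrow> prob_measure_on (P t x)"
  using measurable_space[OF kernel[of t], of x] by (simp add: prob_measure_on_def)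

lemma prob_measure_on_kpush:
  assumes "t \<ge> 0" "prob_measure_on \<nu>"
  shows "prob_measure_on (kpush P t \<nu>)"
proof (rule prob_measure_onI)
  have "\<nu> \<in> space (prob_algebra borel)" using assms by (simp add: prob_measure_on_def)
  then show "prob_space (kpush P t \<nu>)"
    unfolding kpush_def by (rule prob_space_bind'[OF _ kernel[OF assms(1)]])
  show "sets (kpush P t \<nu>) = sets borel"
    unfolding kpush_def using prob_measure_onD[OF assms(2)] prob_measure_onD[OF prob_measure_on_kernel[OF assms(1)]]
    by (subst sets_bind[where N=borel]) auto
qed

lemma kpush_return: "t \<ge> 0 \<Longrightarrow> kpush P t (return borel x) = P t x"
  unfolding kpush_def by (rule bind_return[OF subkernel]) auto

lemma measurable_kernel_cong: "t \<ge> 0 \<Longrightarrow> prob_measure_on \<nu> \<Longrightarrow> P t \<in> \<nu> \<rightarrow>\<^sub>M subprob_algebra borel"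
  using subkernel prob_measure_onD(2) by (metis measurable_cong_sets)

lemma kpush_add:
  assumes "s \<ge> 0" "t \<ge> 0" "prob_measure_on \<nu>"
  shows "kpush P (s + t) \<nu> = kpush P t (kpush P s \<nu>)"
proof -
  have "P (s + t) = (\<lambda>x. P s x \<bind> P t)"
    using feller assms by (auto simp: feller_markov_semigroup_def)
  then show ?thesis
    unfolding kpush_def
    using bind_assoc[OF measurable_kernel_cong[OF assms(1,3)] subkernel[OF assms(2)]] by simp
qed

lemma trans_op_measurable:
  assumes "t \<ge> 0" "f \<in> unit_ball_fns"
  shows "trans_op P t f \<in> borel_measurable borel"
proof -
  have "(\<lambda>x. integral\<^sup>L (P t x) f) \<in> borel_measurable borel"
    by (rule measurable_compose[OF subkernel[OF assms(1)] integral_measurable_subprob_algebra])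
       (use assms(2) unit_ball_fnsD in auto)
  then show ?thesis by (simp add: trans_op_def[abs_def])
qed

lemma trans_op_unit_ball_fns:
  assumes "t \<ge> 0" "f \<in> unit_ball_fns"
  shows "trans_op P t f \<in> unit_ball_fns"
  using trans_op_measurable[OF assms] abs_integral_unit_ball_fns_le[OF prob_measure_on_kernel assms(2)] assms
  by (simp add: unit_ball_fns_def trans_op_def)

lemma integral_kpush:
  assumes "t \<ge> 0" "prob_measure_on \<nu>" "f \<in> unit_ball_fns"
  shows "(\<integral>x. f x \<partial>kpush P t \<nu>) = (\<integral>x. trans_op P t f x \<partial>\<nu>)"
  unfolding kpush_def trans_op_def
proof (rule integral_bind[where B=1 and B'=1 and K=borel])
  show "finite_measure \<nu>" using prob_measure_onD(1)[OF assms(2)] by (simp add: prob_space_def)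
  show "AE x in \<nu>. emeasure (P t x) (space (P t x)) \<le> ennreal 1"
    using prob_measure_onD(1)[OF prob_measure_on_kernel[OF assms(1)]]
    by (simp add: prob_space.emeasure_space_1)
qed (use assms measurable_kernel_cong unit_ball_fnsD in auto)

lemma trans_op_add:
  assumes "s \<ge> 0" "t \<ge> 0" "f \<in> unit_ball_fns"
  shows "trans_op P (s + t) f x = (\<integral>y. trans_op P t f y \<partial>P s x)"
  using integral_kpush[OF assms(2) prob_measure_on_kernel[OF assms(1)] assms(3), of x]
    kpush_add[OF assms(1,2) prob_measure_on_return, of x] assms
  by (simp add: trans_op_def kpush_return)

lemma trans_op_indicator:
  assumes "t \<ge> 0" "A \<in> sets borel"
  shows "trans_op P t (indicator A) x = measure (P t x) A"
  using prob_measure_onD[OF prob_measure_on_kernel[OF assms(1), of x]] by (simp add: trans_op_def)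

lemma trans_op_continuous:
  assumes "t \<ge> 0" "continuous_on UNIV f" "\<And>x. 0 \<le> f x" "\<And>x. f x \<le> 1"
  shows "continuous_on UNIV (trans_op P t f)"
proof -
  have "bounded (range f)"
    using assms(3,4) by (intro boundedI[of _ 1]) auto
  then show ?thesis using assms feller by (auto simp: feller_markov_semigroup_def)
qed

lemma trans_op_nonneg: "(\<And>x. 0 \<le> f x) \<Longrightarrow> 0 \<le> trans_op P t f x"
  by (simp add: trans_op_def)

lemma measure_kpush:
  assumes "t \<ge> 0" "prob_measure_on \<nu>" "A \<in> sets borel"
  shows "measure (kpush P t \<nu>) A = (\<integral>x. measure (P t x) A \<partial>\<nu>)"
  using integral_kpush[OF assms(1,2) indicator_in_unit_ball_fns[OF assms(3)]] assms
    prob_measure_onD[OF prob_measure_on_kpush[OF assms(1,2)]]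
  by (simp add: trans_op_indicator)

text \<open>Duality: the semigroup is moved onto the test function, and
  \<open>trans_op P t f\<close> is again in the unit ball.\<close>

lemma tv_dist_kpush_le:
  assumes "t \<ge> 0" "prob_measure_on \<mu>" "prob_measure_on \<nu>"
  shows "tv_dist (kpush P t \<mu>) (kpush P t \<nu>) \<le> tv_dist \<mu> \<nu>"
  by (rule tv_dist_leI)
     (use assms in \<open>simp add: integral_kpush diff_le_tv_dist trans_op_unit_ball_fns\<close>)

text \<open>Contraction over the remaining time \<open>t - s\<close>. One good time is therefore
  good forever, which is why the merging lemmas only need to produce some \<open>n\<close>.\<close>

lemma tv_dist_kpush_antimono:
  assumes "0 \<le> s" "s \<le> t" "prob_measure_on \<mu>" "prob_measure_on \<nu>"
  shows "tv_dist (kpush P t \<mu>) (kpush P t \<nu>) \<le> tv_dist (kpush P s \<mu>) (kpush P s \<nu>)"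
  using kpush_add[of s "t - s" \<mu>] kpush_add[of s "t - s" \<nu>] assms
    tv_dist_kpush_le[of "t - s" "kpush P s \<mu>" "kpush P s \<nu>"]
  by (simp add: prob_measure_on_kpush)

end

section \<open>Merging of all initial distributions\<close>

text \<open>Both upper limits are unfolded. The radius is common to all \<open>x\<close>, while the
  time threshold depends on \<open>x\<close>; from that time on the estimate is uniform over the
  test functions.\<close>

lemma uec_atD:
  assumes "uec_at P unit_ball_fns z" "e > 0"
  shows "\<exists>r>0. \<forall>x\<in>ball z r. \<forall>\<^sub>F t in at_top. \<forall>f\<in>unit_ball_fns. \<bar>trans_op P t f x - trans_op P t f z\<bar> \<le> e"
proof -
  let ?G = "\<lambda>x. Limsup at_top (\<lambda>t. SUP f\<in>unit_ball_fns. ereal \<bar>trans_op P t f x - trans_op P t f z\<bar>)"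
  have "Limsup (nhds z) ?G < ereal e" using assms by (simp add: uec_at_def)
  then have "\<forall>\<^sub>F x in nhds z. ?G x < ereal e" by (rule Limsup_lessD)
  then obtain r where r: "r > 0" "\<And>x. dist x z < r \<Longrightarrow> ?G x < ereal e"
    by (auto simp: eventually_nhds_metric)
  have "\<forall>\<^sub>F t in at_top. \<forall>f\<in>unit_ball_fns. \<bar>trans_op P t f x - trans_op P t f z\<bar> \<le> e"
    if "x \<in> ball z r" for x
  proof -
    have "?G x < ereal e" using r(2) that by (simp add: dist_commute)
    then have "\<forall>\<^sub>F t in at_top. (SUP f\<in>unit_ball_fns. ereal \<bar>trans_op P t f x - trans_op P t f z\<bar>) < ereal e"
      by (rule Limsup_lessD)
    then show ?thesis
    proof eventually_elim
      case (elim t)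
      show ?case
      proof
        fix f :: "'a \<Rightarrow> real" assume f: "f \<in> unit_ball_fns"
        have "ereal \<bar>trans_op P t f x - trans_op P t f z\<bar> < ereal e"
          by (rule le_less_trans[OF SUP_upper[OF f] elim])
        then show "\<bar>trans_op P t f x - trans_op P t f z\<bar> \<le> e" by simp
      qed
    qed
  qed
  then show ?thesis using r(1) by blast
qed

text \<open>Any real strictly between 0 and the infimum serves. The constant is common to all
  starting points, the time from which it holds is not.\<close>

lemma C1_atD:
  assumes "C1_at P z" "r > 0"
  shows "\<exists>a>0. \<forall>x. \<forall>\<^sub>F t in at_top. a \<le> measure (P t x) (ball z r)"
proof -
  have "0 < (INF x. Liminf at_top (\<lambda>t. ereal (measure (P t x) (ball z r))))"
    using assms by (auto simp: C1_at_def)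
  then obtain a where a: "0 < ereal a" "ereal a < (INF x. Liminf at_top (\<lambda>t. ereal (measure (P t x) (ball z r))))"
    using ereal_dense2 by blast
  have "\<forall>\<^sub>F t in at_top. a \<le> measure (P t x) (ball z r)" for x
  proof -
    have "ereal a < Liminf at_top (\<lambda>t. ereal (measure (P t x) (ball z r)))"
      using a(2) by (rule less_le_trans) (auto intro: INF_lower)
    then have "\<forall>\<^sub>F t in at_top. ereal a < ereal (measure (P t x) (ball z r))" by (rule less_LiminfD)
    then show ?thesis by eventually_elim auto
  qed
  then show ?thesis using a(1) by auto
qed

lemma eventually_at_top_nat: "eventually Q at_top \<Longrightarrow> \<forall>\<^sub>F n in sequentially. Q (real n)"
  by (rule eventually_compose_filterlim[OF _ filterlim_real_sequentially])

text \<open>\<open>\<mu>1\<close> is \<open>\<mu>\<close> conditioned on \<open>B\<close>, with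
  density \<open>p\<close>; the remainder has density \<open>q\<close>, nonnegative because
  \<open>a \<le> measure \<mu> B\<close>. The weight may be smaller than the mass of
  \<open>B\<close>, so two measures can be split with the same weight.\<close>

lemma prob_measure_split:
  fixes \<mu> :: "'a::topological_space measure"
  assumes "prob_measure_on \<mu>" "B \<in> sets borel" "0 < a" "a < 1" "a \<le> measure \<mu> B"
  obtains \<mu>1 \<mu>2 where "prob_measure_on \<mu>1" "prob_measure_on \<mu>2" "AE x in \<mu>1. x \<in> B"
    "\<And>f. f \<in> unit_ball_fns \<Longrightarrow> (\<integral>x. f x \<partial>\<mu>) = a * (\<integral>x. f x \<partial>\<mu>1) + (1 - a) * (\<integral>x. f x \<partial>\<mu>2)"
proof -
  interpret prob_space \<mu> using prob_measure_onD[OF assms(1)] by simp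
  have sets[measurable_cong]: "sets \<mu> = sets borel" using prob_measure_onD[OF assms(1)] by simp
  have B[measurable]: "B \<in> sets borel" by fact
  define b where "b = measure \<mu> B"
  have b: "0 < b" "a \<le> b" using assms by (auto simp: b_def)
  define p :: "'a \<Rightarrow> real" where "p x = indicator B x / b" for x
  define q :: "'a \<Rightarrow> real" where "q x = (1 - a * p x) / (1 - a)" for x
  have p0: "0 \<le> p x" for x using b by (simp add: p_def)
  have q0: "0 \<le> q x" for x using b assms by (auto simp: p_def q_def indicator_def)
  have [measurable]: "p \<in> borel_measurable borel" "q \<in> borel_measurable borel"
    unfolding p_def[abs_def] q_def[abs_def] by measurable
  have intp: "integrable \<mu> p"
    unfolding p_def[abs_def] using integrable_unit_ball_fns[OF assms(1) indicator_in_unit_ball_fns[OF B]] by simp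
  have Ip: "(\<integral>x. p x \<partial>\<mu>) = 1"
    unfolding p_def[abs_def] using b by (simp add: b_def sets prob_measure_onD[OF assms(1)])
  have intq: "integrable \<mu> q"
    unfolding q_def[abs_def] using intp by auto
  have Iq: "(\<integral>x. q x \<partial>\<mu>) = 1"
    unfolding q_def[abs_def] using intp Ip assms by (simp add: prob_space)
  have dens: "prob_measure_on (density \<mu> (\<lambda>x. ennreal (g x)))"
    if "integrable \<mu> g" "\<And>x. 0 \<le> g x" "(\<integral>x. g x \<partial>\<mu>) = 1" "g \<in> borel_measurable borel" for g
  proof (rule prob_measure_onI)
    show "prob_space (density \<mu> (\<lambda>x. ennreal (g x)))"
    proof
      have "g \<in> borel_measurable \<mu>" using that(4) by measurable
      then show "emeasure (density \<mu> (\<lambda>x. ennreal (g x))) (space (density \<mu> (\<lambda>x. ennreal (g x)))) = 1"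
        using that by (simp add: emeasure_density nn_integral_eq_integral cong: nn_integral_cong)
    qed
  qed (simp add: sets)
  show ?thesis
  proof (rule that[of "density \<mu> (\<lambda>x. ennreal (p x))" "density \<mu> (\<lambda>x. ennreal (q x))"])
    show "prob_measure_on (density \<mu> (\<lambda>x. ennreal (p x)))" "prob_measure_on (density \<mu> (\<lambda>x. ennreal (q x)))"
      using dens intp intq p0 q0 Ip Iq by auto
    show "AE x in density \<mu> (\<lambda>x. ennreal (p x)). x \<in> B"
      by (subst AE_density) (auto simp: p_def indicator_def)
    fix f :: "'a \<Rightarrow> real" assume f: "f \<in> unit_ball_fns"
    then have [measurable]: "f \<in> borel_measurable borel" by (rule unit_ball_fnsD)
    have intf: "integrable \<mu> f" by (rule integrable_unit_ball_fns[OF assms(1) f])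
    have intfp: "integrable \<mu> (\<lambda>x. p x * f x)"
      using intp by (rule Bochner_Integration.integrable_bound)
        (use p0 unit_ball_fnsD(2)[OF f] in \<open>auto simp: abs_mult intro!: mult_left_le\<close>)
    have "(1 - a) * (\<integral>x. q x * f x \<partial>\<mu>) = (\<integral>x. f x - a * (p x * f x) \<partial>\<mu>)"
      unfolding integral_mult_right_zero[symmetric] q_def using assms(4)
      by (intro Bochner_Integration.integral_cong) (auto simp: field_simps)
    also have "\<dots> = (\<integral>x. f x \<partial>\<mu>) - a * (\<integral>x. p x * f x \<partial>\<mu>)"
      using intf intfp by simp
    finally show "(\<integral>x. f x \<partial>\<mu>) = a * (\<integral>x. f x \<partial>density \<mu> (\<lambda>x. ennreal (p x)))
        + (1 - a) * (\<integral>x. f x \<partial>density \<mu> (\<lambda>x. ennreal (q x)))"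
      using p0 q0 by (simp add: integral_density)
  qed
qed

context feller_semigroup
begin

text \<open>The hypothesis is pointwise in the starting point, with no common time; integrating it
  over \<open>\<mu>\<close> by dominated convergence costs \<open>\<delta>\<close>.\<close>

lemma kpush_merges_near:
  assumes near: "\<And>x. x \<in> B \<Longrightarrow> \<forall>\<^sub>F t in at_top. \<forall>f\<in>unit_ball_fns. \<bar>trans_op P t f x - trans_op P t f z\<bar> \<le> e"
    and \<mu>: "prob_measure_on \<mu>" "AE x in \<mu>. x \<in> B" and "\<delta> > 0"
  shows "\<exists>n. tv_dist (kpush P (real n) \<mu>) (P (real n) z) \<le> e + \<delta>"
proof (rule ccontr)
  \<comment> \<open>Fixing one bad test function per \<open>n\<close> avoids integrating a supremum over uncountably many
    functions, whose measurability would have to be proved.\<close>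
  assume "\<not> ?thesis"
  then have "\<forall>n. \<exists>f\<in>unit_ball_fns. \<bar>(\<integral>x. f x \<partial>kpush P (real n) \<mu>) - (\<integral>x. f x \<partial>P (real n) z)\<bar> > e + \<delta>"
    using tv_dist_leI by (meson not_le)
  then obtain F where F: "\<And>n. F n \<in> unit_ball_fns"
    "\<And>n. \<bar>(\<integral>x. F n x \<partial>kpush P (real n) \<mu>) - (\<integral>x. F n x \<partial>P (real n) z)\<bar> > e + \<delta>" by metis
  interpret prob_space \<mu> using prob_measure_onD[OF \<mu>(1)] by simp
  have sets[measurable_cong]: "sets \<mu> = sets borel" using prob_measure_onD[OF \<mu>(1)] by simp
  have T: "trans_op P (real n) (F n) \<in> unit_ball_fns" for n using F(1) trans_op_unit_ball_fns by simp
  note [measurable] = unit_ball_fnsD(1)[OF T]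
  let ?h = "\<lambda>n x. \<bar>trans_op P (real n) (F n) x - trans_op P (real n) (F n) z\<bar>"
  have "\<forall>\<^sub>F n in sequentially. (\<integral>x. ?h n x \<partial>\<mu>) \<le> e + \<delta>"
  proof (rule eventually_integral_le[where c=2])
    show "\<bar>?h n x\<bar> \<le> 2" for n x
      using unit_ball_fnsD(2)[OF T, of n x] unit_ball_fnsD(2)[OF T, of n z] by auto
    show "AE x in \<mu>. \<forall>\<^sub>F n in sequentially. ?h n x \<le> e"
      using \<mu>(2)
    proof eventually_elim
      case (elim x)
      from eventually_at_top_nat[OF near[OF elim]] show ?case
        by eventually_elim (use F(1) in blast)
    qed
  qed (use \<open>\<delta> > 0\<close> in auto)
  then obtain n where n: "(\<integral>x. ?h n x \<partial>\<mu>) \<le> e + \<delta>" by (auto simp: eventually_sequentially)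
  have "(\<integral>x. F n x \<partial>kpush P (real n) \<mu>) - (\<integral>x. F n x \<partial>P (real n) z)
      = (\<integral>x. trans_op P (real n) (F n) x - trans_op P (real n) (F n) z \<partial>\<mu>)"
    using integrable_unit_ball_fns[OF \<mu>(1) T, of n] \<mu>(1) F(1)
    by (simp add: integral_kpush prob_space) (simp add: trans_op_def)
  also have "\<bar>\<dots>\<bar> \<le> (\<integral>x. ?h n x \<partial>\<mu>)" by (rule integral_abs_bound)
  finally show False using n F(2)[of n] by simp
qed

text \<open>A Fatou type estimate, obtained from \<open>eventually_integral_le\<close> for the
  negated masses with slack \<open>a - a'\<close>.\<close>

lemma kpush_eventually_charges:
  assumes ev: "\<And>x. \<forall>\<^sub>F t in at_top. a \<le> measure (P t x) B"
    and \<mu>: "prob_measure_on \<mu>" and B: "B \<in> sets borel" and "a' < a"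
  shows "\<forall>\<^sub>F n in sequentially. a' \<le> measure (kpush P (real n) \<mu>) B"
proof -
  interpret prob_space \<mu> using prob_measure_onD[OF \<mu>(1)] by simp
  have sets[measurable_cong]: "sets \<mu> = sets borel" using prob_measure_onD[OF \<mu>(1)] by simp
  have "trans_op P (real n) (indicator B) = (\<lambda>x. measure (P (real n) x) B)" for n
    by (simp add: fun_eq_iff trans_op_indicator[OF _ B])
  then have "(\<lambda>x. measure (P (real n) x) B) \<in> unit_ball_fns" for n
    using trans_op_unit_ball_fns[OF of_nat_0_le_iff indicator_in_unit_ball_fns[OF B]] by metis
  note T[measurable] = unit_ball_fnsD[OF this]
  have "\<forall>\<^sub>F n in sequentially. (\<integral>x. - measure (P (real n) x) B \<partial>\<mu>) \<le> - a + (a - a')"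
  proof (rule eventually_integral_le[where c=1])
    show "AE x in \<mu>. \<forall>\<^sub>F n in sequentially. - measure (P (real n) x) B \<le> - a"
      using eventually_at_top_nat[OF ev] by simp
  qed (use T \<open>a' < a\<close> in \<open>auto\<close>)
  then show ?thesis
    by eventually_elim (simp add: measure_kpush[OF _ \<mu> B])
qed

lemma merging:
  assumes uec: "uec_at P unit_ball_fns z" and C1: "C1_at P z"
    and \<mu>\<nu>: "prob_measure_on \<mu>" "prob_measure_on \<nu>" and "\<delta> > 0"
  shows "\<exists>n. tv_dist (kpush P (real n) \<mu>) (kpush P (real n) \<nu>) \<le> \<delta>"
proof -
  \<comment> \<open>\<open>Q s\<close>: every pair of initial distributions ends up within distance \<open>s\<close>. The best such \<open>s\<close>
    satisfies \<open>s \<le> a * e + (1 - a) * s\<close>, hence \<open>s \<le> e\<close> for every \<open>e\<close>.\<close>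
  define Q where "Q s \<longleftrightarrow> (\<forall>\<mu> \<nu> \<delta>. prob_measure_on \<mu> \<longrightarrow> prob_measure_on \<nu> \<longrightarrow> \<delta> > 0 \<longrightarrow>
      (\<exists>n. tv_dist (kpush P (real n) \<mu>) (kpush P (real n) \<nu>) \<le> s + \<delta>))" for s
  have step: "\<exists>a>0. a < 1 \<and> (\<forall>s. Q s \<longrightarrow> Q (a * e + (1 - a) * s))" if "e > 0" for e
  proof -
    \<comment> \<open>A quarter of \<open>e\<close> for the pointwise estimate and a quarter for the
      slack in \<open>kpush_merges_near\<close> put each split-off piece within \<open>e / 2\<close>
      of the law started at \<open>z\<close>, hence the two within \<open>e\<close> of each
      other.\<close>
    obtain r where r: "r > 0" and near: "\<And>x. x \<in> ball z r \<Longrightarrow>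
        \<forall>\<^sub>F t in at_top. \<forall>f\<in>unit_ball_fns. \<bar>trans_op P t f x - trans_op P t f z\<bar> \<le> e / 4"
      using uec_atD[OF uec, of "e / 4"] \<open>e > 0\<close> by auto
    obtain c where c: "c > 0" "\<And>x. \<forall>\<^sub>F t in at_top. c \<le> measure (P t x) (ball z r)"
      using C1_atD[OF C1 r] by blast
    \<comment> \<open>Strictly below \<open>c\<close>, because
      \<open>kpush_eventually_charges\<close> loses a little, and below 1, so that a remainder is
      left. It does not depend on \<open>s\<close>, so the step can be applied at the
      infimum.\<close>
    define a where "a = min (c / 2) (1 / 2)"
    have a: "0 < a" "a < 1" "a < c" using c(1) by (auto simp: a_def)
    have "Q (a * e + (1 - a) * s)" if "Q s" for s
      unfolding Q_def
    proof (intro allI impI)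
      fix \<mu> \<nu> :: "'a measure" and \<delta> :: real
      assume \<mu>: "prob_measure_on \<mu>" and \<nu>: "prob_measure_on \<nu>" and "\<delta> > 0"
      have "\<forall>\<^sub>F n in sequentially. a \<le> measure (kpush P (real n) \<mu>) (ball z r) \<and> a \<le> measure (kpush P (real n) \<nu>) (ball z r)"
        by (intro eventually_conj kpush_eventually_charges[OF c(2)] \<mu> \<nu> a) auto
      then obtain k where k: "a \<le> measure (kpush P (real k) \<mu>) (ball z r)" "a \<le> measure (kpush P (real k) \<nu>) (ball z r)"
        by (auto simp: eventually_sequentially)
      note pk = prob_measure_on_kpush[OF of_nat_0_le_iff \<mu>, of k] prob_measure_on_kpush[OF of_nat_0_le_iff \<nu>, of k]
      obtain \<mu>1 \<mu>2 where m: "prob_measure_on \<mu>1" "prob_measure_on \<mu>2" "AE x in \<mu>1. x \<in> ball z r"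
        "\<And>f. f \<in> unit_ball_fns \<Longrightarrow> (\<integral>x. f x \<partial>kpush P (real k) \<mu>) = a * (\<integral>x. f x \<partial>\<mu>1) + (1 - a) * (\<integral>x. f x \<partial>\<mu>2)"
        using prob_measure_split[OF pk(1) _ a(1,2) k(1)] by (metis borel_open open_ball)
      obtain \<nu>1 \<nu>2 where n: "prob_measure_on \<nu>1" "prob_measure_on \<nu>2" "AE x in \<nu>1. x \<in> ball z r"
        "\<And>f. f \<in> unit_ball_fns \<Longrightarrow> (\<integral>x. f x \<partial>kpush P (real k) \<nu>) = a * (\<integral>x. f x \<partial>\<nu>1) + (1 - a) * (\<integral>x. f x \<partial>\<nu>2)"
        using prob_measure_split[OF pk(2) _ a(1,2) k(2)] by (metis borel_open open_ball)
      obtain n1 where n1: "tv_dist (kpush P (real n1) \<mu>1) (P (real n1) z) \<le> e / 4 + e / 4"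
        using kpush_merges_near[OF near m(1,3)] \<open>e > 0\<close> by (metis zero_less_divide_iff zero_less_numeral)
      obtain n2 where n2: "tv_dist (kpush P (real n2) \<nu>1) (P (real n2) z) \<le> e / 4 + e / 4"
        using kpush_merges_near[OF near n(1,3)] \<open>e > 0\<close> by (metis zero_less_divide_iff zero_less_numeral)
      obtain n3 where n3: "tv_dist (kpush P (real n3) \<mu>2) (kpush P (real n3) \<nu>2) \<le> s + \<delta>"
        using \<open>Q s\<close> m(2) n(2) \<open>\<delta> > 0\<close> unfolding Q_def by blast
      \<comment> \<open>By monotonicity in time all three estimates hold at \<open>N\<close>. The
        splitting takes place at time \<open>k\<close>, so the total time is
        \<open>k + N\<close>.\<close>
      define N where "N = real (max n1 (max n2 n3))"
      have N: "N \<ge> 0" "real n1 \<le> N" "real n2 \<le> N" "real n3 \<le> N" by (auto simp: N_def)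
      have pN: "prob_measure_on (kpush P N \<kappa>)" if "prob_measure_on \<kappa>" for \<kappa>
        using prob_measure_on_kpush N that by blast
      have ret: "P (real i) z = kpush P (real i) (return borel z)" for i
        by (simp add: kpush_return)
      have b1: "tv_dist (kpush P N \<mu>1) (kpush P N (return borel z)) \<le> e / 2"
        using tv_dist_kpush_antimono[OF _ N(2) m(1) prob_measure_on_return[of z]] n1 by (simp add: ret)
      have b2: "tv_dist (kpush P N (return borel z)) (kpush P N \<nu>1) \<le> e / 2"
        using tv_dist_kpush_antimono[OF _ N(3) n(1) prob_measure_on_return[of z]] n2
        by (subst tv_dist_commute) (simp add: ret)
      have B1: "tv_dist (kpush P N \<mu>1) (kpush P N \<nu>1) \<le> e"
        using tv_dist_triangle[OF pN[OF m(1)] pN[OF prob_measure_on_return] pN[OF n(1)], of z] b1 b2 by simp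
      have B2: "tv_dist (kpush P N \<mu>2) (kpush P N \<nu>2) \<le> s + \<delta>"
        using tv_dist_kpush_antimono[OF _ N(4) m(2) n(2)] n3 by simp
      have "tv_dist (kpush P (real k + N) \<mu>) (kpush P (real k + N) \<nu>) \<le> a * e + (1 - a) * (s + \<delta>)"
      proof (rule tv_dist_leI)
        fix f :: "'a \<Rightarrow> real" assume f: "f \<in> unit_ball_fns"
        let ?T = "trans_op P N f"
        have T: "?T \<in> unit_ball_fns" using f N trans_op_unit_ball_fns by blast
        let ?d = "\<lambda>\<mu> \<nu>. (\<integral>x. ?T x \<partial>\<mu>) - (\<integral>x. ?T x \<partial>\<nu>)"
        have eq: "(\<integral>x. f x \<partial>kpush P (real k + N) \<mu>) - (\<integral>x. f x \<partial>kpush P (real k + N) \<nu>) = a * ?d \<mu>1 \<nu>1 + (1 - a) * ?d \<mu>2 \<nu>2"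
          using N(1) pk f \<mu> \<nu> by (simp add: kpush_add integral_kpush m(4)[OF T] n(4)[OF T]) (simp add: algebra_simps)
        have "\<bar>a * ?d \<mu>1 \<nu>1 + (1 - a) * ?d \<mu>2 \<nu>2\<bar> \<le> a * \<bar>?d \<mu>1 \<nu>1\<bar> + (1 - a) * \<bar>?d \<mu>2 \<nu>2\<bar>"
          by (rule order_trans[OF abs_triangle_ineq]) (use a in \<open>simp add: abs_mult\<close>)
        also have "\<dots> \<le> a * e + (1 - a) * (s + \<delta>)"
        proof (intro add_mono mult_left_mono)
          show "\<bar>?d \<mu>1 \<nu>1\<bar> \<le> e"
            using diff_le_tv_dist[OF pN[OF m(1)] pN[OF n(1)] f] B1
            by (simp add: integral_kpush[OF N(1) m(1) f] integral_kpush[OF N(1) n(1) f])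
          show "\<bar>?d \<mu>2 \<nu>2\<bar> \<le> s + \<delta>"
            using diff_le_tv_dist[OF pN[OF m(2)] pN[OF n(2)] f] B2
            by (simp add: integral_kpush[OF N(1) m(2) f] integral_kpush[OF N(1) n(2) f])
        qed (use a in auto)
        finally show "\<bar>(\<integral>x. f x \<partial>kpush P (real k + N) \<mu>) - (\<integral>x. f x \<partial>kpush P (real k + N) \<nu>)\<bar> \<le> a * e + (1 - a) * (s + \<delta>)"
          unfolding eq .
      qed
      also have "\<dots> \<le> a * e + (1 - a) * s + \<delta>"
        using a \<open>\<delta> > 0\<close> by (simp add: algebra_simps)
      finally show "\<exists>n. tv_dist (kpush P (real n) \<mu>) (kpush P (real n) \<nu>) \<le> a * e + (1 - a) * s + \<delta>"
        by (intro exI[of _ "k + max n1 (max n2 n3)"]) (simp add: N_def)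
    qed
    then show ?thesis using a by blast
  qed
  let ?S = "{s. 0 \<le> s \<and> Q s}"
  have "tv_dist (kpush P (real 0) \<mu>) (kpush P (real 0) \<nu>) \<le> 2 + \<delta>"
    if "prob_measure_on \<mu>" "prob_measure_on \<nu>" "\<delta> > 0" for \<mu> \<nu> \<delta>
    using tv_dist_le_2[of "kpush P (real 0) \<mu>" "kpush P (real 0) \<nu>"] that prob_measure_on_kpush by fastforce
  then have "Q 2" unfolding Q_def by blast
  then have Q2: "2 \<in> ?S" by simp
  have bdd: "bdd_below ?S" by (rule bdd_belowI[of _ 0]) auto
  \<comment> \<open>The infimum is attained: the arbitrary \<open>\<delta>\<close> in
    \<open>Q\<close> absorbs the gap between \<open>s\<close> and \<open>Inf ?S\<close>.\<close>
  have QI: "Q (Inf ?S)"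
    unfolding Q_def[of "Inf ?S"]
  proof (intro allI impI)
    fix \<mu> \<nu> :: "'a measure" and \<delta> :: real
    assume *: "prob_measure_on \<mu>" "prob_measure_on \<nu>" "\<delta> > 0"
    have "?S \<noteq> {}" using Q2 by blast
    moreover have "Inf ?S < Inf ?S + \<delta> / 2" using * by simp
    ultimately obtain s where s: "Q s" "s < Inf ?S + \<delta> / 2"
      using cInf_lessD[of ?S] by blast
    moreover have "\<delta> / 2 > 0" using * by simp
    ultimately obtain n where n: "tv_dist (kpush P (real n) \<mu>) (kpush P (real n) \<nu>) \<le> s + \<delta> / 2"
      using * unfolding Q_def by blast
    show "\<exists>n. tv_dist (kpush P (real n) \<mu>) (kpush P (real n) \<nu>) \<le> Inf ?S + \<delta>"
      by (rule exI[of _ n]) (use n s(2) in linarith)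
  qed
  have nn: "0 \<le> Inf ?S" by (rule cInf_greatest) (use Q2 in blast)+
  have "Inf ?S \<le> e" if "e > 0" for e
  proof -
    obtain a where a: "a > 0" "a < 1" "\<And>s. Q s \<Longrightarrow> Q (a * e + (1 - a) * s)" using step[OF \<open>e > 0\<close>] by blast
    then have "a * e + (1 - a) * Inf ?S \<in> ?S" using QI nn \<open>e > 0\<close> by simp
    then have "Inf ?S \<le> a * e + (1 - a) * Inf ?S" using bdd by (rule cInf_lower)
    then have "a * Inf ?S \<le> a * e" by (simp add: algebra_simps)
    then show ?thesis using a by simp
  qed
  then have "Inf ?S \<le> 0" using field_le_epsilon[of "Inf ?S" 0] by simp
  then have "Inf ?S = 0" using nn by (rule antisym)
  then have "Q 0" using QI by simp
  then show ?thesis using \<mu>\<nu> \<open>\<delta> > 0\<close> unfolding Q_def by auto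
qed

end

section \<open>Topological and measure-theoretic tools\<close>

lemma open_indicator_approx:
  fixes U :: "'a::metric_space set"
  assumes "open U"
  obtains f :: "nat \<Rightarrow> 'a \<Rightarrow> real" where "\<And>n. continuous_on UNIV (f n)" "\<And>n x. 0 \<le> f n x"
    "\<And>n x. f n x \<le> indicator U x" "\<And>x. (\<lambda>n. f n x) \<longlonglongrightarrow> indicator U x"
\<comment> \<open>The whole space is treated apart because \<open>infdist\<close> to the empty set
  is 0 by convention.\<close>
proof (cases "U = UNIV")
  case True
  then show ?thesis by (intro that[of "\<lambda>_ _. 1"]) auto
next
  case False
  define f :: "nat \<Rightarrow> 'a \<Rightarrow> real" where "f n x = min 1 (real n * infdist x (- U))" for n x
  have out: "infdist x (- U) = 0" if "x \<notin> U" for x using that by simp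
  show ?thesis
  proof (rule that[of f])
    show "continuous_on UNIV (f n)" for n
      unfolding f_def[abs_def] by (intro continuous_intros)
    show "0 \<le> f n x" "f n x \<le> indicator U x" for n x
      using out[of x] by (auto simp: f_def indicator_def infdist_nonneg)
    show "(\<lambda>n. f n x) \<longlonglongrightarrow> indicator U x" for x
    proof (cases "x \<in> U")
      case True
      have "infdist x (- U) \<noteq> 0"
        using in_closed_iff_infdist_zero[of "- U" x] True False assms by auto
      then have d: "infdist x (- U) > 0" using infdist_nonneg[of x "- U"] by linarith
      obtain k :: nat where k: "1 / infdist x (- U) \<le> real k" using real_arch_simple by blast
      have "f n x = 1" if "n \<ge> k" for n
      proof -
        have "1 / infdist x (- U) \<le> real n" using k that by linarith
        then show ?thesis using d by (simp add: f_def field_simps)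
      qed
      then show ?thesis using True
        by (intro tendsto_eventually) (auto simp: eventually_sequentially)
    qed (auto simp: f_def out)
  qed
qed

lemma integral_tendsto_measure:
  fixes f :: "nat \<Rightarrow> 'a::metric_space \<Rightarrow> real"
  assumes \<kappa>: "prob_measure_on \<kappa>" and "open U" and f: "\<And>n. continuous_on UNIV (f n)" "\<And>n x. 0 \<le> f n x"
    "\<And>n x. f n x \<le> indicator U x" "\<And>x. (\<lambda>n. f n x) \<longlonglongrightarrow> indicator U x"
  shows "(\<lambda>n. \<integral>x. f n x \<partial>\<kappa>) \<longlonglongrightarrow> measure \<kappa> U"
proof -
  interpret prob_space \<kappa> using prob_measure_onD[OF \<kappa>] by simp
  have s: "sets \<kappa> = sets borel" "space \<kappa> = UNIV" using prob_measure_onD[OF \<kappa>] by simp_all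
  have U: "U \<in> sets \<kappa>" using \<open>open U\<close> s by simp
  have f1: "f n x \<le> 1" for n x
    by (rule order_trans[OF f(3)]) (simp add: indicator_def)
  have fm: "f n \<in> borel_measurable \<kappa>" for n
    using borel_measurable_continuous_onI[OF f(1)] s(1) by (metis measurable_cong_sets)
  have "(\<lambda>n. \<integral>x. f n x \<partial>\<kappa>) \<longlonglongrightarrow> (\<integral>x. indicator U x \<partial>\<kappa>)"
    using f(2,4) f1 fm U by (intro integral_dominated_convergence[where w="\<lambda>_. 1"]) auto
  then show ?thesis using s by simp
qed

text \<open>Open sets come first, their indicators being limits of continuous functions from below;
  Borel sets follow by outer regularity of \<open>\<nu>\<close>.\<close>

lemma measure_le_of_continuous_le:
  fixes \<mu> \<nu> :: "'a::polish_space measure"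
  assumes \<mu>: "prob_measure_on \<mu>" and \<nu>: "prob_measure_on \<nu>" and "c \<ge> 0"
    and le: "\<And>f. continuous_on UNIV f \<Longrightarrow> (\<And>x. 0 \<le> f x) \<Longrightarrow> (\<And>x. f x \<le> 1) \<Longrightarrow>
      c * (\<integral>x. f x \<partial>\<mu>) \<le> (\<integral>x. f x \<partial>\<nu>) + b"
    and A: "A \<in> sets borel"
  shows "c * measure \<mu> A \<le> measure \<nu> A + b"
proof -
  interpret m: prob_space \<mu> using prob_measure_onD[OF \<mu>] by simp
  interpret n: prob_space \<nu> using prob_measure_onD[OF \<nu>] by simp
  have sets: "sets \<mu> = sets borel" "sets \<nu> = sets borel"
    using prob_measure_onD[OF \<mu>] prob_measure_onD[OF \<nu>] by simp_all
  have op: "c * measure \<mu> U \<le> measure \<nu> U + b" if "open U" for U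
  proof -
    obtain f :: "nat \<Rightarrow> 'a \<Rightarrow> real" where f: "\<And>n. continuous_on UNIV (f n)" "\<And>n x. 0 \<le> f n x"
      "\<And>n x. f n x \<le> indicator U x" "\<And>x. (\<lambda>n. f n x) \<longlonglongrightarrow> indicator U x"
      using open_indicator_approx[OF \<open>open U\<close>] by blast
    have f1: "f n x \<le> 1" for n x
      by (rule order_trans[OF f(3)]) (simp add: indicator_def)
    have "(\<lambda>n. c * (\<integral>x. f n x \<partial>\<mu>)) \<longlonglongrightarrow> c * measure \<mu> U"
      "(\<lambda>n. (\<integral>x. f n x \<partial>\<nu>) + b) \<longlonglongrightarrow> measure \<nu> U + b"
      by (intro tendsto_intros integral_tendsto_measure[OF _ \<open>open U\<close>] \<mu> \<nu> f)+
    then show ?thesis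
      by (rule LIMSEQ_le) (use le f f1 in auto)
  qed
  show ?thesis
  proof (rule field_le_epsilon)
    fix e :: real assume "e > 0"
    have "emeasure \<nu> A < ennreal (measure \<nu> A + e)"
      using \<open>e > 0\<close> by (simp add: n.emeasure_eq_measure ennreal_lessI)
    then have "(INF U \<in> {U. A \<subseteq> U \<and> open U}. emeasure \<nu> U) < ennreal (measure \<nu> A + e)"
      using outer_regular[OF sets(2) _ A] n.emeasure_space_1 by simp
    then obtain U where U: "A \<subseteq> U" "open U" "emeasure \<nu> U < ennreal (measure \<nu> A + e)"
      by (auto simp: INF_less_iff)
    have "measure \<nu> U < measure \<nu> A + e"
      using U(3) by (simp add: n.emeasure_eq_measure ennreal_less_iff)
    moreover have "c * measure \<mu> A \<le> c * measure \<mu> U"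
      using U sets \<open>c \<ge> 0\<close> by (intro mult_left_mono m.finite_measure_mono) auto
    ultimately show "c * measure \<mu> A \<le> measure \<nu> A + b + e"
      using op[OF U(2)] by linarith
  qed
qed

text \<open>Baire's theorem is applied in \<open>Y\<close> with its subspace topology, which is
  completely metrizable since \<open>Y\<close> is closed; hence the interior found is relative to
  \<open>Y\<close>.\<close>

lemma Baire_closed_cover:
  fixes Y :: "'a::polish_space set" and A :: "nat \<Rightarrow> 'a set"
  assumes Y: "closed Y" "Y \<noteq> {}" and A: "\<And>n. closed (A n)" "Y \<subseteq> (\<Union>n. A n)"
  obtains n y r where "y \<in> Y" "r > 0" "ball y r \<inter> Y \<subseteq> A n"
proof -
  have "\<exists>n. top_of_set Y interior_of (Y \<inter> A n) \<noteq> {}"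
  proof (rule ccontr)
    assume "\<not> ?thesis"
    then have *: "\<And>n. top_of_set Y interior_of (Y \<inter> A n) = {}" by simp
    have "completely_metrizable_space (top_of_set Y)"
      using Y(1) by (intro completely_metrizable_space_closedin completely_metrizable_space_euclidean) auto
    then have "top_of_set Y interior_of \<Union>(range (\<lambda>n. Y \<inter> A n)) = {}"
      by (intro Baire_category_alt) (use * A(1) in \<open>auto intro!: closedin_closed_Int\<close>)
    moreover have "\<Union>(range (\<lambda>n. Y \<inter> A n)) = Y" using A(2) by auto
    ultimately show False using Y(2) interior_of_topspace[of "top_of_set Y"] by simp
  qed
  then obtain n y where "y \<in> top_of_set Y interior_of (Y \<inter> A n)" by blast
  then obtain T where T: "openin (top_of_set Y) T" "y \<in> T" "T \<subseteq> Y \<inter> A n"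
    by (auto simp: interior_of_def)
  then obtain r where r: "r > 0" "ball y r \<inter> Y \<subseteq> T"
    by (auto simp: openin_contains_ball)
  show ?thesis by (rule that[of y r n]) (use T r in auto)
qed

text \<open>By the Lindelof property the union of all null balls is a countable union of such balls,
  hence null.\<close>

lemma measure_eq_0_if_locally_null:
  fixes \<mu> :: "'a::polish_space measure"
  assumes \<mu>: "prob_measure_on \<mu>" and null: "\<And>x. x \<in> G \<Longrightarrow> \<exists>r>0. measure \<mu> (ball x r) = 0"
    and G: "G \<in> sets borel"
  shows "measure \<mu> G = 0"
proof -
  interpret prob_space \<mu> using prob_measure_onD[OF \<mu>] by simp
  have sets: "sets \<mu> = sets borel" using prob_measure_onD[OF \<mu>] by simp
  let ?F = "{ball x r | x r. measure \<mu> (ball x r) = 0}"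
  obtain F where F: "F \<subseteq> ?F" "countable F" "\<Union>F = \<Union>?F"
    by (rule Lindelof[of ?F]) auto
  have N: "(\<Union>B\<in>F. B) \<in> null_sets \<mu>"
  proof (rule null_sets_UN')
    show "B \<in> null_sets \<mu>" if "B \<in> F" for B
      using that F(1) sets by (auto simp: null_sets_def emeasure_eq_measure)
  qed fact
  have "G \<in> sets \<mu>" using G sets by simp
  moreover have "G \<subseteq> (\<Union>B\<in>F. B)"
  proof
    fix x assume "x \<in> G"
    then obtain r where "r > 0" "measure \<mu> (ball x r) = 0" using null by blast
    then have "x \<in> \<Union>?F" by (intro UnionI[of "ball x r"]) auto
    then show "x \<in> (\<Union>B\<in>F. B)" using F(3) by simp
  qed
  ultimately have "G \<in> null_sets \<mu>" by (rule null_sets_subset[OF N])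
  then show ?thesis by (simp add: null_sets_def measure_def)
qed

text \<open>A Tychonoff argument: the sequence lives in a compact cube with one coordinate per
  \<open>i\<close>, so it has a cluster point \<open>L\<close>, and \<open>G\<close> plays the role
  of a subnet converging to it. For uncountably many indices a convergent subsequence need not
  exist.\<close>

lemma ex_filter_tendsto:
  fixes \<phi> :: "nat \<Rightarrow> 'i \<Rightarrow> real"
  assumes "\<And>n i. 0 \<le> \<phi> n i" "\<And>n i. \<phi> n i \<le> 1"
  obtains G L where "G \<noteq> bot" "G \<le> sequentially" "\<And>i. ((\<lambda>n. \<phi> n i) \<longlongrightarrow> L i) G"
proof -
  have "compactin (product_topology (\<lambda>_. euclidean) UNIV) (PiE (UNIV :: 'i set) (\<lambda>_. {0..1::real}))"
    by (subst compactin_PiE) auto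
  then have "compact (PiE (UNIV :: 'i set) (\<lambda>_. {0..1::real}))"
    by (simp add: euclidean_product_topology)
  moreover have "filtermap \<phi> sequentially \<noteq> bot" by (simp add: filtermap_bot_iff)
  moreover have "\<forall>\<^sub>F p in filtermap \<phi> sequentially. p \<in> PiE UNIV (\<lambda>_. {0..1})"
    using assms by (simp add: eventually_filtermap PiE_UNIV_domain)
  ultimately obtain L where L: "inf (nhds L) (filtermap \<phi> sequentially) \<noteq> bot"
    unfolding compact_filter by blast
  define G where "G = inf (filtercomap \<phi> (nhds L)) sequentially"
  have "G \<noteq> bot"
  proof
    \<comment> \<open>If the refined filter were trivial, \<open>\<phi>\<close> would eventually
      avoid a neighbourhood of its cluster point.\<close>
    assume "G = bot"
    then obtain Q R where "eventually Q (filtercomap \<phi> (nhds L))" and R: "eventually R sequentially"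
      and QR: "\<And>n. Q n \<Longrightarrow> R n \<Longrightarrow> False"
      unfolding G_def trivial_limit_def eventually_inf by auto
    then obtain Q' where Q': "eventually Q' (nhds L)" "\<And>n. Q' (\<phi> n) \<Longrightarrow> Q n"
      by (auto simp: eventually_filtercomap)
    have "eventually (\<lambda>p. \<not> Q' p) (filtermap \<phi> sequentially)"
      unfolding eventually_filtermap using R by eventually_elim (use Q' QR in blast)
    then have "eventually (\<lambda>_. False) (inf (nhds L) (filtermap \<phi> sequentially))"
      unfolding eventually_inf using Q'(1) by blast
    then show False using L by (simp add: trivial_limit_def)
  qed
  moreover have "G \<le> sequentially" by (simp add: G_def)
  moreover have "((\<lambda>n. \<phi> n i) \<longlongrightarrow> L i) G" for i
  proof -
    have \<phi>: "filterlim \<phi> (nhds L) G"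
      unfolding G_def filterlim_def by (meson filtermap_filtercomap filtermap_mono inf_le1 order_trans)
    show ?thesis
    proof (rule topological_tendstoI)
      fix S :: "real set" assume S: "open S" "L i \<in> S"
      have "continuous_on UNIV (\<lambda>p :: 'i \<Rightarrow> real. p i)" by (rule continuous_on_product_coordinates)
      then have "open ((\<lambda>p. p i) -` S)" using S(1) by (rule open_vimage[rotated])
      then show "\<forall>\<^sub>F n in G. \<phi> n i \<in> S" using topological_tendstoD[OF \<phi>, of "(\<lambda>p. p i) -` S"] S(2) by simp
    qed
  qed
  ultimately show ?thesis using that by blast
qed

text \<open>Passing to complements reverses the inequality, as both measures have total mass
  1.\<close>

lemma prob_measure_on_eqI_le:
  assumes "prob_measure_on \<mu>" "prob_measure_on \<nu>"
    and le: "\<And>A. A \<in> sets borel \<Longrightarrow> measure \<mu> A \<le> measure \<nu> A"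
  shows "\<mu> = \<nu>"
proof (rule prob_measure_on_eqI[OF assms(1,2)])
  fix A :: "'a set" assume A: "A \<in> sets borel"
  note D = prob_measure_onD[OF assms(1)] prob_measure_onD[OF assms(2)]
  interpret m: prob_space \<mu> by fact
  interpret n: prob_space \<nu> by fact
  have "measure \<mu> (- A) \<le> measure \<nu> (- A)" using A by (intro le) auto
  then show "measure \<mu> A = measure \<nu> A"
    using le[OF A] A D m.prob_compl[of A] n.prob_compl[of A] by (simp add: Compl_eq_Diff_UNIV)
qed

section \<open>Existence of an invariant measure\<close>

text \<open>Finite additivity of \<open>L\<close> already makes Borel sets Caratheodory measurable,
  so the outer measure built from \<open>L\<close> is a measure on them; countable additivity would
  only be needed for equality with \<open>L\<close>. The formula by covers is kept in the conclusion
  because it encodes maximality among the measures below \<open>L\<close>.\<close>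

lemma countably_additive_part:
  fixes L :: "'a::topological_space set \<Rightarrow> real"
  assumes nonneg: "\<And>A. 0 \<le> L A" and empty: "L {} = 0"
    and add: "\<And>A B. A \<in> sets borel \<Longrightarrow> B \<in> sets borel \<Longrightarrow> A \<inter> B = {} \<Longrightarrow> L (A \<union> B) = L A + L B"
  obtains M where "sets M = sets borel"
    "\<And>A. A \<in> sets borel \<Longrightarrow> emeasure M A = outer_measure (sets borel) (\<lambda>A. ennreal (L A)) A"
    "\<And>A. A \<in> sets borel \<Longrightarrow> emeasure M A \<le> ennreal (L A)"
proof -
  let ?f = "\<lambda>A. ennreal (L A)"
  let ?O = "outer_measure (sets borel) ?f"
  interpret B: sigma_algebra "UNIV :: 'a set" "sets borel"
    using sets.sigma_algebra_axioms[of "borel :: 'a measure"] by simp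
  have pos: "positive (sets borel) ?f" by (simp add: positive_def empty)
  have addf: "additive (sets borel) ?f"
    by (simp add: additive_def add nonneg)
  have inc: "increasing (sets borel) ?f"
    by (rule B.additive_increasing[OF pos addf])
  interpret Pw: sigma_algebra "UNIV :: 'a set" "Pow UNIV" by (rule sigma_algebra_Pow)
  have "measure_space UNIV (lambda_system UNIV (Pow UNIV) ?O) ?O"
    by (rule Pw.caratheodory_lemma[OF B.outer_measure_space_outer_measure[OF pos inc]])
  then have ms: "measure_space UNIV (sets borel) ?O"
    by (rule measure_down[OF _ B.sigma_algebra_axioms B.algebra_subset_lambda_system[OF pos inc addf]])
  define M where "M = measure_of UNIV (sets borel) ?O"
  have sets: "sets M = sets borel" by (simp add: M_def)
  have em: "emeasure M A = ?O A" if "A \<in> sets borel" for A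
    unfolding M_def using ms that
    by (intro emeasure_measure_of_sigma) (auto simp: measure_space_def)
  have le: "?O A \<le> ?f A" if A: "A \<in> sets borel" for A
  proof -
    have "?O A \<le> (\<Sum>i. ?f (if i = (0::nat) then A else {}))"
      by (rule B.outer_measure_le[OF pos inc]) (use A in \<open>auto split: if_splits\<close>)
    also have "\<dots> = ?f A"
      by (subst suminf_finite[of "{0}"]) (auto simp: empty)
    finally show ?thesis .
  qed
  show ?thesis by (rule that[of M]) (use sets em le in auto)
qed

context feller_semigroup
begin

text \<open>The invariant measure is the countably additive part of a limit, along some filter, of the
  laws \<open>P n z\<close>. The lower bound by \<open>h\<close> is what keeps this part from vanishing.\<close>

lemma ex_invariant_of_lower_bound:
  assumes h: "prob_measure_on h" and "a > 0"
    and lower: "\<And>A. A \<in> sets borel \<Longrightarrow> \<forall>\<^sub>F n in sequentially. a * measure h A \<le> measure (P (real n) z) A + a / 2"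
    and asym: "\<And>A. A \<in> sets borel \<Longrightarrow>
      (\<lambda>n. measure (P (real n + 1) z) A - measure (P (real n) z) A) \<longlonglongrightarrow> 0"
  obtains \<mu> where "prob_measure_on \<mu>" "kpush P 1 \<mu> = \<mu>"
proof -
  note pz = prob_measure_on_kernel[OF of_nat_0_le_iff]
  have pzD: "prob_space (P (real n) z)" "sets (P (real n) z) = sets borel" "space (P (real n) z) = UNIV" for n
    using prob_measure_onD[OF pz] by auto
  \<comment> \<open>The limit is taken set by set, so \<open>L\<close> inherits only finite
    additivity.\<close>
  obtain G L where G: "G \<noteq> bot" "G \<le> sequentially" "\<And>A. ((\<lambda>n. measure (P (real n) z) A) \<longlongrightarrow> L A) G"
    using ex_filter_tendsto[of "\<lambda>n A. measure (P (real n) z) A"] prob_space.prob_le_1[OF pzD(1)] by auto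
  have L0: "0 \<le> L A" for A
    by (rule tendsto_lowerbound[OF G(3)]) (auto simp: G(1))
  have Lemp: "L {} = 0"
    using tendsto_unique[OF G(1) G(3)[of "{}"]] by simp
  have Ladd: "L (A \<union> B) = L A + L B" if "A \<in> sets borel" "B \<in> sets borel" "A \<inter> B = {}" for A B
  proof (rule tendsto_unique[OF G(1) G(3)])
    have "measure (P (real n) z) (A \<union> B) = measure (P (real n) z) A + measure (P (real n) z) B" for n
    proof -
      interpret prob_space "P (real n) z" by (rule pzD)
      show ?thesis using that pzD by (intro finite_measure_Union) auto
    qed
    then show "((\<lambda>n. measure (P (real n) z) (A \<union> B)) \<longlongrightarrow> L A + L B) G"
      by (simp add: tendsto_add G(3))
  qed
  have Llow: "a * measure h A \<le> L A + a / 2" if "A \<in> sets borel" for A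
    by (rule tendsto_lowerbound[OF tendsto_add[OF G(3) tendsto_const] _ G(1)])
       (rule filter_leD[OF G(2) lower[OF that]])
  have LT: "((\<lambda>n. measure (P (real n + 1) z) A) \<longlongrightarrow> L A) G" if "A \<in> sets borel" for A
    using tendsto_add[OF tendsto_mono[OF G(2) asym[OF that]] G(3)[of A]] by simp
  obtain M where M: "sets M = sets borel"
    "\<And>A. A \<in> sets borel \<Longrightarrow> emeasure M A = outer_measure (sets borel) (\<lambda>A. ennreal (L A)) A"
    "\<And>A. A \<in> sets borel \<Longrightarrow> emeasure M A \<le> ennreal (L A)"
    using countably_additive_part[of L, OF L0 Lemp Ladd] by blast
  have spM: "space M = UNIV" using sets_eq_imp_space_eq[OF M(1)] by simp
  have Lsum: "(\<Sum>i<k. L (A i)) = L (\<Union>i<k. A i)" if "range A \<subseteq> sets borel" "disjoint_family A" for A :: "nat \<Rightarrow> 'a set" and k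
  proof (induction k)
    case (Suc k)
    have "(\<Union>i<k. A i) \<inter> A k = {}"
      using disjoint_family_onD[OF that(2), of _ k] by fastforce
    then have "L ((\<Union>i<k. A i) \<union> A k) = L (\<Union>i<k. A i) + L (A k)"
      using that(1) by (intro Ladd) auto
    then show ?case using Suc by (simp add: lessThan_Suc Un_commute)
  qed (simp add: Lemp)
  \<comment> \<open>In any countable Borel cover finitely many sets carry more than 3/4 of
    \<open>h\<close>, and the lower bound then gives their union at least
    \<open>a * (3 / 4) - a / 2\<close> under \<open>L\<close>.\<close>
  have low: "ennreal (a / 4) \<le> emeasure M UNIV"
  proof -
    have "ennreal (a / 4) \<le> (\<Sum>i. ennreal (L (A i)))"
      if A: "range A \<subseteq> sets borel" "disjoint_family A" "UNIV \<subseteq> (\<Union>i. A i)" for A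
    proof -
      interpret h: prob_space h using prob_measure_onD[OF h] by simp
      have sh: "sets h = sets borel" "space h = UNIV" using prob_measure_onD[OF h] by simp_all
      have "(\<lambda>k. measure h (\<Union>i<k. A i)) \<longlonglongrightarrow> measure h (\<Union>k. \<Union>i<k. A i)"
      proof (rule h.finite_Lim_measure_incseq)
        show "range (\<lambda>k. \<Union>i<k. A i) \<subseteq> sets h" using A(1) sh by auto
        show "incseq (\<lambda>k. \<Union>i<k. A i)" by (rule incseq_SucI) (auto simp: lessThan_Suc)
      qed
      moreover have "(\<Union>k. \<Union>i<k. A i) = UNIV" using A(3) by auto
      ultimately have "(\<lambda>k. measure h (\<Union>i<k. A i)) \<longlonglongrightarrow> 1"
        using h.prob_space sh by simp
      then have "\<forall>\<^sub>F k in sequentially. 3 / 4 < measure h (\<Union>i<k. A i)"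
        by (rule order_tendstoD) simp
      then obtain k where k: "3 / 4 < measure h (\<Union>i<k. A i)" by (auto simp: eventually_sequentially)
      have "a * (3 / 4) \<le> a * measure h (\<Union>i<k. A i)" using k \<open>a > 0\<close> by (intro mult_left_mono) auto
      also have "\<dots> \<le> L (\<Union>i<k. A i) + a / 2" using A(1) by (intro Llow) auto
      finally have "a / 4 \<le> (\<Sum>i<k. L (A i))" using Lsum[OF A(1,2)] by simp
      then have "ennreal (a / 4) \<le> (\<Sum>i<k. ennreal (L (A i)))" using L0 by (simp add: ennreal_leI)
      also have "\<dots> \<le> (\<Sum>i. ennreal (L (A i)))" by (rule sum_le_suminf) auto
      finally show ?thesis .
    qed
    then have "ennreal (a / 4) \<le> outer_measure (sets borel) (\<lambda>A. ennreal (L A)) UNIV"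
      unfolding outer_measure_def by (intro INF_greatest) auto
    then show ?thesis using M(2)[of UNIV] by simp
  qed
  have P1: "P 1 \<in> M \<rightarrow>\<^sub>M subprob_algebra borel"
    using subkernel[of 1] M(1) by (simp cong: measurable_cong_sets)
  \<comment> \<open>Convergence along \<open>G\<close> is only set by set, so the integral is
    approached by simple functions \<open>s\<close>. Their integrals against \<open>M\<close> are at
    most finite sums over \<open>L\<close>, which are limits of integrals against
    \<open>P n z\<close>; these are bounded by the mass of \<open>A\<close> under
    \<open>P (n + 1) z\<close>, which tends to \<open>L A\<close> by \<open>asym\<close>.\<close>
  have T_le_L: "(\<integral>\<^sup>+x. emeasure (P 1 x) A \<partial>M) \<le> ennreal (L A)" if A: "A \<in> sets borel" for A
    unfolding nn_integral_def
  proof (rule SUP_least, clarify)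
    fix s assume s: "simple_function M s" "s \<le> (\<lambda>x. emeasure (P 1 x) A)"
    have s1: "s x \<le> 1" for x
    proof -
      interpret prob_space "P 1 x" using prob_measure_onD[OF prob_measure_on_kernel[of 1 x]] by simp
      have "s x \<le> emeasure (P 1 x) A" using s(2) by (simp add: le_fun_def)
      also have "\<dots> \<le> 1" by (rule emeasure_le_1)
      finally show ?thesis .
    qed
    have fin: "finite (range s)" using simple_functionD(1)[OF s(1)] spM by simp
    have ms: "s -` {v} \<in> sets borel" for v
      using simple_functionD(2)[OF s(1), of "{v}"] spM M(1) by simp
    have lim: "((\<lambda>n. \<Sum>v\<in>range s. v * emeasure (P (real n) z) (s -` {v})) \<longlongrightarrow> (\<Sum>v\<in>range s. v * ennreal (L (s -` {v})))) G"
    proof (intro tendsto_sum ennreal_tendsto_cmult)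
      fix v assume "v \<in> range s"
      then show "v < top" using s1 by (metis ennreal_one_less_top imageE le_less_trans)
      show "((\<lambda>n. emeasure (P (real n) z) (s -` {v})) \<longlongrightarrow> ennreal (L (s -` {v}))) G"
        using tendsto_ennrealI[OF G(3)[of "s -` {v}"]]
        by (simp add: finite_measure.emeasure_eq_measure[OF prob_space.finite_measure[OF pzD(1)]])
    qed
    have lim2: "((\<lambda>n. emeasure (P (real n + 1) z) A) \<longlongrightarrow> ennreal (L A)) G"
    proof -
      have "emeasure (P (real n + 1) z) A = ennreal (measure (P (real n + 1) z) A)" for n
        using prob_measure_onD(1)[OF prob_measure_on_kernel[of "real n + 1" z]]
        by (intro finite_measure.emeasure_eq_measure prob_space.finite_measure) simp
      then show ?thesis using tendsto_ennrealI[OF LT[OF A]] by simp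
    qed
    have le: "(\<Sum>v\<in>range s. v * emeasure (P (real n) z) (s -` {v})) \<le> emeasure (P (real n + 1) z) A" for n
    proof -
      have sn: "simple_function (P (real n) z) s"
        using s(1) M(1) pzD(2)[of n] simple_function_cong_algebra[of M "P (real n) z" s] spM pzD(3)[of n] by simp
      have "(\<Sum>v\<in>range s. v * emeasure (P (real n) z) (s -` {v})) = integral\<^sup>S (P (real n) z) s"
        by (simp add: simple_integral_def pzD)
      also have "\<dots> \<le> (\<integral>\<^sup>+x. emeasure (P 1 x) A \<partial>P (real n) z)"
        unfolding nn_integral_def using sn s(2) by (intro SUP_upper) auto
      also have "\<dots> = emeasure (kpush P 1 (P (real n) z)) A"
        unfolding kpush_def using A pzD(3) measurable_kernel_cong[of 1, OF _ pz[of n z]]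
        by (subst emeasure_bind[where N=borel]) auto
      also have "kpush P 1 (P (real n) z) = P (real n + 1) z"
        using kpush_add[OF of_nat_0_le_iff _ prob_measure_on_return, of 1 n z] by (simp add: kpush_return)
      finally show ?thesis .
    qed
    have "integral\<^sup>S M s = (\<Sum>v\<in>range s. v * emeasure M (s -` {v}))"
      by (simp add: simple_integral_def spM)
    also have "\<dots> \<le> (\<Sum>v\<in>range s. v * ennreal (L (s -` {v})))"
      by (intro sum_mono mult_left_mono M(3) ms) auto
    also have "\<dots> \<le> ennreal (L A)"
      by (rule tendsto_le[OF G(1) lim2 lim]) (simp add: le)
    finally show "integral\<^sup>S M s \<le> ennreal (L A)" .
  qed
  have T: "emeasure (M \<bind> P 1) A = (\<integral>\<^sup>+x. emeasure (P 1 x) A \<partial>M)" if "A \<in> sets borel" for A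
    using that spM by (intro emeasure_bind[OF _ P1]) auto
  have setsT: "sets (M \<bind> P 1) = sets borel"
    using spM prob_measure_onD[OF prob_measure_on_kernel[of 1]] by (subst sets_bind[where N=borel]) auto
  \<comment> \<open>Maximality of \<open>M\<close>: its image under \<open>P 1\<close> is countably
    additive and below \<open>L\<close>, hence below every cover sum in the infimum defining
    \<open>M\<close>.\<close>
  have T_le: "(\<integral>\<^sup>+x. emeasure (P 1 x) A \<partial>M) \<le> emeasure M A" if A: "A \<in> sets borel" for A
    unfolding M(2)[OF A] outer_measure_def
  proof (rule INF_greatest, clarify)
    fix B :: "nat \<Rightarrow> 'a set" assume B: "range B \<subseteq> sets borel" "A \<subseteq> (\<Union>i. B i)"
    have "emeasure (M \<bind> P 1) A \<le> emeasure (M \<bind> P 1) (\<Union>i. B i)"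
      using B setsT by (intro emeasure_mono) auto
    also have "\<dots> \<le> (\<Sum>i. emeasure (M \<bind> P 1) (B i))"
      using B setsT by (intro emeasure_subadditive_countably) auto
    also have "\<dots> \<le> (\<Sum>i. ennreal (L (B i)))"
      using B T T_le_L by (intro suminf_le) auto
    finally show "(\<integral>\<^sup>+x. emeasure (P 1 x) A \<partial>M) \<le> (\<Sum>i. ennreal (L (B i)))" using T[OF A] by simp
  qed
  let ?c = "emeasure M UNIV"
  have c: "?c \<noteq> 0" "?c \<noteq> top"
    using low \<open>a > 0\<close> M(3)[of UNIV] by (auto simp: top_unique)
  define \<mu> where "\<mu> = scale_measure (inverse ?c) M"
  have \<mu>: "prob_measure_on \<mu>"
  proof (rule prob_measure_onI)
    show "prob_space \<mu>"
      by standard (use c spM ennreal_divide_self[of ?c] in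
        \<open>simp add: \<mu>_def space_scale_measure less_top mult.commute divide_ennreal_def\<close>)
  qed (simp add: \<mu>_def M(1))
  have k1: "prob_measure_on (kpush P 1 \<mu>)" using prob_measure_on_kpush[OF _ \<mu>] by simp
  \<comment> \<open>Subinvariance suffices, because both sides are probability measures.\<close>
  have "kpush P 1 \<mu> = \<mu>"
  proof (rule prob_measure_on_eqI_le[OF k1 \<mu>])
    fix A :: "'a set" assume A: "A \<in> sets borel"
    have "(\<lambda>x. emeasure (P 1 x) A) \<in> borel_measurable M"
      by (rule measurable_compose[OF P1 measurable_emeasure_subprob_algebra[OF A]])
    then have "emeasure (kpush P 1 \<mu>) A = inverse ?c * (\<integral>\<^sup>+x. emeasure (P 1 x) A \<partial>M)"
      unfolding kpush_def using A prob_measure_onD[OF \<mu>] measurable_kernel_cong[OF _ \<mu>, of 1]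
      by (subst emeasure_bind[where N=borel]) (auto simp: \<mu>_def nn_integral_scale_measure)
    also have "\<dots> \<le> inverse ?c * emeasure M A" by (intro mult_left_mono T_le A) simp
    also have "\<dots> = emeasure \<mu> A" by (simp add: \<mu>_def)
    finally have "emeasure (kpush P 1 \<mu>) A \<le> emeasure \<mu> A" .
    then show "measure (kpush P 1 \<mu>) A \<le> measure \<mu> A"
      unfolding measure_def using prob_measure_onD(1)[OF \<mu>]
      by (intro enn2real_mono) (auto simp: less_top[symmetric] prob_space.finite_measure finite_measure.emeasure_finite)
  qed
  then show ?thesis using that \<mu> by blast
qed

end

section \<open>Lower bound from Baire's theorem, and convergence to equilibrium\<close>

context feller_semigroup
begin

lemma kpush_kernel: "s \<ge> 0 \<Longrightarrow> t \<ge> 0 \<Longrightarrow> kpush P t (P s x) = P (s + t) x"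
  using kpush_add[OF _ _ prob_measure_on_return, of s t x] by (simp add: kpush_return)

lemma merging_tendsto:
  assumes "uec_at P unit_ball_fns z" "C1_at P z" and \<mu>\<nu>: "prob_measure_on \<mu>" "prob_measure_on \<nu>"
  shows "((\<lambda>t. tv_dist (kpush P t \<mu>) (kpush P t \<nu>)) \<longlongrightarrow> 0) at_top"
proof (rule tendstoI)
  fix e :: real assume "e > 0"
  then obtain n where n: "tv_dist (kpush P (real n) \<mu>) (kpush P (real n) \<nu>) \<le> e / 2"
    using merging[OF assms, of "e / 2"] by auto
  show "\<forall>\<^sub>F t in at_top. dist (tv_dist (kpush P t \<mu>) (kpush P t \<nu>)) 0 < e"
    using eventually_ge_at_top[of "real n"]
  proof eventually_elim
    case (elim t)
    then have "t \<ge> 0" using of_nat_0_le_iff[of n] by linarith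
    then have "0 \<le> tv_dist (kpush P t \<mu>) (kpush P t \<nu>)"
      by (intro tv_dist_nonneg prob_measure_on_kpush \<mu>\<nu>)
    then show ?case
      using tv_dist_kpush_antimono[OF _ elim \<mu>\<nu>] n \<open>e > 0\<close> by simp
  qed
qed

text \<open>\<open>h\<close> is the law \<open>P N z\<close> at one fixed time \<open>N\<close>. The
  error is half of the weight \<open>a\<close>, so the bound has content on sets to which
  \<open>h\<close> gives more than one half.\<close>

lemma ex_lower_bound:
  assumes uec: "uec_at P unit_ball_fns z" and C1: "C1_at P z"
  obtains h a where "prob_measure_on h" "a > 0"
    "\<And>A. A \<in> sets borel \<Longrightarrow> \<forall>\<^sub>F n in sequentially. a * measure h A \<le> measure (P (real n) z) A + a / 2"
proof -
  have pz: "prob_measure_on (P (real n) x)" for n x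
    by (rule prob_measure_on_kernel) simp
  have pzD: "prob_space (P (real n) x)" "sets (P (real n) x) = sets borel" "space (P (real n) x) = UNIV" for n x
    using prob_measure_onD[OF pz] by auto
  have int_ind: "integrable (P (real n) z) (indicator S :: _ \<Rightarrow> real)" if "S \<in> sets borel" for n S
    by (rule integrable_unit_ball_fns[OF pz indicator_in_unit_ball_fns[OF that]])
  define acc where "acc U \<longleftrightarrow> (\<exists>a>0. \<forall>\<^sub>F n in sequentially. a \<le> measure (P (real n) z) U)" for U
  have acc_mono: "acc V" if "acc U" "U \<subseteq> V" "V \<in> sets borel" for U V
  proof -
    have "measure (P (real n) z) U \<le> measure (P (real n) z) V" for n
    proof -
      interpret prob_space "P (real n) z" by (rule pzD)
      show ?thesis using that pzD by (intro finite_measure_mono) auto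
    qed
    with that(1) show ?thesis unfolding acc_def by (meson eventually_mono order_trans)
  qed
  have acc_z: "acc (ball z r)" if "r > 0" for r
    using C1_atD[OF C1 that] eventually_at_top_nat unfolding acc_def by blast
  \<comment> \<open>The points all of whose neighbourhoods keep being visited. By the Feller property the process
    started at \<open>z\<close> never leaves this closed set, so Baire's theorem can be applied inside it.\<close>
  define Y where "Y = {y. \<forall>r>0. acc (ball y r)}"
  have "open (- Y)"
    unfolding open_contains_ball
  proof
    fix w assume "w \<in> - Y"
    then obtain r where r: "r > 0" "\<not> acc (ball w r)" by (auto simp: Y_def)
    have "y \<notin> Y" if "y \<in> ball w (r / 2)" for y
    proof
      assume "y \<in> Y"
      then have "acc (ball y (r / 2))" using r by (simp add: Y_def)
      moreover have "ball y (r / 2) \<subseteq> ball w r"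
      proof
        fix x assume "x \<in> ball y (r / 2)"
        then show "x \<in> ball w r" using that dist_triangle[of w x y] by simp
      qed
      ultimately show False using r(2) acc_mono by auto
    qed
    then show "\<exists>e>0. ball w e \<subseteq> - Y" using r by (intro exI[of _ "r / 2"]) auto
  qed
  then have Y: "closed Y" "z \<in> Y" "- Y \<in> sets borel"
    using acc_z by (auto simp: closed_def Y_def)
  \<comment> \<open>If the law at time \<open>s\<close> charged the ball around \<open>w\<close>,
    then by Feller continuity so would, with a uniform bound, the laws started near
    \<open>z\<close>. Since \<open>P n z\<close> keeps charging neighbourhoods of \<open>z\<close>,
    the ball would keep being charged at the times \<open>n + s\<close>, against its choice.\<close>
  have stay: "measure (P (real s) z) (- Y) = 0" for s
  proof (rule measure_eq_0_if_locally_null[OF pz _ Y(3)])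
    fix w assume "w \<in> - Y"
    then obtain r where r: "r > 0" "\<not> acc (ball w r)" by (auto simp: Y_def)
    have "measure (P (real s) z) (ball w r) = 0"
    proof (rule ccontr)
      assume "measure (P (real s) z) (ball w r) \<noteq> 0"
      then have pos: "0 < measure (P (real s) z) (ball w r)" by (simp add: zero_less_measure_iff)
      obtain f :: "nat \<Rightarrow> 'a \<Rightarrow> real" where f: "\<And>n. continuous_on UNIV (f n)" "\<And>n x. 0 \<le> f n x"
        "\<And>n x. f n x \<le> indicator (ball w r) x" "\<And>x. (\<lambda>n. f n x) \<longlonglongrightarrow> indicator (ball w r) x"
        using open_indicator_approx[OF open_ball] by blast
      from order_tendstoD(1)[OF integral_tendsto_measure[OF pz open_ball f] pos]
      obtain k where k: "0 < trans_op P (real s) (f k) z"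
        by (auto simp: eventually_sequentially trans_op_def)
      define g where "g = f k"
      have g: "continuous_on UNIV g" "\<And>x. 0 \<le> g x" "\<And>x. g x \<le> indicator (ball w r) x"
        using f by (auto simp: g_def)
      have g1: "g x \<le> 1" for x
        by (rule order_trans[OF g(3)]) (simp add: indicator_def)
      have gU: "g \<in> unit_ball_fns" by (rule continuous_in_unit_ball_fns[OF g(1,2) g1])
      define c where "c = trans_op P (real s) g z / 2"
      have c: "c > 0" "c < trans_op P (real s) g z" using k by (auto simp: c_def g_def)
      have "continuous_on UNIV (trans_op P (real s) g)" by (rule trans_op_continuous[OF _ g(1,2) g1]) simp
      then have "open {x. c < trans_op P (real s) g x}" by (intro open_Collect_less) auto
      then obtain r' where r': "r' > 0" "ball z r' \<subseteq> {x. c < trans_op P (real s) g x}"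
        using c(2) by (auto simp: open_contains_ball)
      obtain a where a: "a > 0" "\<forall>\<^sub>F n in sequentially. a \<le> measure (P (real n) z) (ball z r')"
        using acc_z[OF r'(1)] unfolding acc_def by blast
      have "\<forall>\<^sub>F n in sequentially. c * a \<le> measure (P (real (n + s)) z) (ball w r)"
        using a(2)
      proof eventually_elim
        case (elim n)
        interpret n: prob_space "P (real n) z" by (rule pzD)
        interpret ns: prob_space "P (real (n + s)) z" by (rule pzD)
        have sb: "ball z r' \<in> sets (P (real n) z)" "ball w r \<in> sets (P (real (n + s)) z)" unfolding pzD by simp_all
        have "c * a \<le> c * measure (P (real n) z) (ball z r')" using elim c by simp
        also have "\<dots> = (\<integral>x. c * indicator (ball z r') x \<partial>P (real n) z)" using sb by (simp add: pzD)
        also have "\<dots> \<le> (\<integral>x. trans_op P (real s) g x \<partial>P (real n) z)"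
        proof (rule integral_mono)
          show "integrable (P (real n) z) (trans_op P (real s) g)"
            by (rule integrable_unit_ball_fns[OF pz trans_op_unit_ball_fns[OF _ gU]]) simp
          show "c * indicator (ball z r') x \<le> trans_op P (real s) g x" for x
            using r'(2) trans_op_nonneg[where f=g and t="real s" and x=x, OF g(2)] by (auto simp: indicator_def)
        qed (use int_ind[of "ball z r'"] in auto)
        also have "\<dots> = (\<integral>x. g x \<partial>P (real (n + s)) z)"
          using trans_op_add[OF _ _ gU, of "real n" "real s" z] by (simp add: trans_op_def)
        also have "\<dots> \<le> (\<integral>x. indicator (ball w r) x \<partial>P (real (n + s)) z)"
          by (rule integral_mono[OF integrable_unit_ball_fns[OF pz gU] int_ind g(3)]) simp
        also have "\<dots> = measure (P (real (n + s)) z) (ball w r)" using sb pzD(3)[of "n + s" z] by simp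
        finally show ?case .
      qed
      then have "acc (ball w r)"
        unfolding acc_def using eventually_sequentially_seg[of "\<lambda>n. c * a \<le> measure (P (real n) z) (ball w r)" s] c a
        by (intro exI[of _ "c * a"]) auto
      then show False using r by simp
    qed
    then show "\<exists>r>0. measure (P (real s) z) (ball w r) = 0" using r by blast
  qed
  \<comment> \<open>Testing against continuous functions only makes each \<open>A N\<close> an
    intersection of closed sets, by the Feller property. The comparison in \<open>A N\<close> is
    one-sided, since only a lower bound is wanted.\<close>
  define C where "C = {f :: 'a \<Rightarrow> real. continuous_on UNIV f \<and> (\<forall>x. 0 \<le> f x) \<and> (\<forall>x. f x \<le> 1)}"
  define A where "A N = (\<Inter>f\<in>C. {x. trans_op P (real N) f z \<le> trans_op P (real N) f x + 1 / 2})" for N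
  have clA: "closed (A N)" for N
    unfolding A_def
  proof (intro closed_INT ballI closed_Collect_le continuous_intros)
    show "continuous_on UNIV (trans_op P (real N) f)" if "f \<in> C" for f
      using that by (intro trans_op_continuous) (auto simp: C_def)
  qed
  have "x \<in> (\<Union>N. A N)" for x
  proof -
    \<comment> \<open>Merging of the point masses at \<open>z\<close> and \<open>x\<close> provides
      the index of a set containing \<open>x\<close>.\<close>
    obtain n where n: "tv_dist (P (real n) z) (P (real n) x) \<le> 1 / 2"
      using merging[OF uec C1 prob_measure_on_return[of z] prob_measure_on_return[of x], of "1 / 2"]
      by (auto simp: kpush_return)
    have "trans_op P (real n) f z \<le> trans_op P (real n) f x + 1 / 2" if "f \<in> C" for f
    proof -
      have "f \<in> unit_ball_fns" using that by (intro continuous_in_unit_ball_fns) (auto simp: C_def)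
      from diff_le_tv_dist[OF pz pz this, of n z n x] n show ?thesis by (simp add: trans_op_def)
    qed
    then show ?thesis by (auto simp: A_def)
  qed
  then have "Y \<subseteq> (\<Union>N. A N)" by blast
  moreover have "Y \<noteq> {}" using Y(2) by blast
  ultimately obtain N y r where B: "y \<in> Y" "r > 0" "ball y r \<inter> Y \<subseteq> A N"
    using Baire_closed_cover[of Y A] Y(1) clA by metis
  then obtain a where a: "a > 0" "\<forall>\<^sub>F n in sequentially. a \<le> measure (P (real n) z) (ball y r)"
    by (auto simp: Y_def acc_def)
  \<comment> \<open>Under \<open>P n z\<close> the ball has mass at least \<open>a\<close> and, by
    \<open>stay\<close>, lies in \<open>A N\<close> up to a null set. Running for a further time
    \<open>N\<close> from there reproduces \<open>P N z\<close> with weight \<open>a\<close>, up to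
    an error \<open>a / 2\<close>.\<close>
  have main: "\<forall>\<^sub>F n in sequentially. a * measure (P (real N) z) S \<le> measure (P (real (n + N)) z) S + a / 2"
    if S: "S \<in> sets borel" for S
    using a(2)
  proof eventually_elim
    case (elim n)
    interpret n: prob_space "P (real n) z" by (rule pzD)
    have sA: "A N \<in> sets (P (real n) z)" "- Y \<in> sets (P (real n) z)" using clA[of N] Y by (simp_all add: pzD)
    have "measure (P (real n) z) (ball y r) \<le> measure (P (real n) z) (A N \<union> - Y)"
      using B sA by (intro n.finite_measure_mono) auto
    also have "\<dots> \<le> measure (P (real n) z) (A N) + measure (P (real n) z) (- Y)"
      by (rule measure_Un_le[OF sA])
    finally have aA: "a \<le> measure (P (real n) z) (A N)" using elim stay[of n] by simp
    show ?case
    proof (rule measure_le_of_continuous_le[OF pz pz _ _ S])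
      fix f :: "'a \<Rightarrow> real" assume f: "continuous_on UNIV f" "\<And>x. 0 \<le> f x" "\<And>x. f x \<le> 1"
      let ?T = "trans_op P (real N) f"
      have fU: "f \<in> unit_ball_fns" by (rule continuous_in_unit_ball_fns[OF f])
      have "f \<in> C" using f by (simp add: C_def)
      then have AT: "?T z - 1 / 2 \<le> ?T x" if "x \<in> A N" for x using that by (force simp: A_def)
      have eq: "(\<integral>x. f x \<partial>P (real (n + N)) z) = (\<integral>x. ?T x \<partial>P (real n) z)"
        using trans_op_add[OF _ _ fU, of "real n" "real N" z] by (simp add: trans_op_def)
      have "a * (?T z - 1 / 2) \<le> (\<integral>x. ?T x \<partial>P (real n) z)"
      \<comment> \<open>Replacing the mass of \<open>A N\<close> by its lower bound \<open>a\<close>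
        needs a nonnegative factor; otherwise the left side is not positive anyway.\<close>
      proof (cases "?T z \<le> 1 / 2")
        case True
        then have "a * (?T z - 1 / 2) \<le> 0" using a(1) by (simp add: mult_nonneg_nonpos)
        also have "0 \<le> (\<integral>x. ?T x \<partial>P (real n) z)"
          by (rule Bochner_Integration.integral_nonneg) (rule trans_op_nonneg[where f=f, OF f(2)])
        finally show ?thesis .
      next
        case False
        then have "a * (?T z - 1 / 2) \<le> measure (P (real n) z) (A N) * (?T z - 1 / 2)"
          using aA by (intro mult_right_mono) auto
        also have "\<dots> = (\<integral>x. (?T z - 1 / 2) * indicator (A N) x \<partial>P (real n) z)"
          using sA by (simp add: pzD)
        also have "\<dots> \<le> (\<integral>x. ?T x \<partial>P (real n) z)"
        proof (rule integral_mono)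
          show "integrable (P (real n) z) ?T"
            by (rule integrable_unit_ball_fns[OF pz trans_op_unit_ball_fns[OF _ fU]]) simp
          show "(?T z - 1 / 2) * indicator (A N) x \<le> ?T x" for x
            using AT[of x] trans_op_nonneg[where f=f and t="real N" and x=x, OF f(2)] by (auto simp: indicator_def)
        qed (use int_ind[of "A N"] clA[of N] in auto)
        finally show ?thesis .
      qed
      then show "a * (\<integral>x. f x \<partial>P (real N) z) \<le> (\<integral>x. f x \<partial>P (real (n + N)) z) + a / 2"
        unfolding eq using trans_op_def[of P "real N" f z] by (simp add: algebra_simps)
    qed (use a in simp)
  qed
  show ?thesis
  proof (rule that[OF pz a(1)])
    show "\<forall>\<^sub>F n in sequentially. a * measure (P (real N) z) S \<le> measure (P (real n) z) S + a / 2"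
      if "S \<in> sets borel" for S
      using main[OF that] eventually_sequentially_seg[of "\<lambda>n. a * measure (P (real N) z) S \<le> measure (P (real n) z) S + a / 2" N]
      by simp
  qed
qed

lemma convergence_of_uec_C1:
  assumes uec: "uec_at P unit_ball_fns z" and C1: "C1_at P z"
  shows "\<exists>\<mu>. invariant_measure P \<mu> \<and> (\<forall>\<mu>'. invariant_measure P \<mu>' \<longrightarrow> \<mu>' = \<mu>) \<and>
    (\<forall>\<nu>. prob_measure_on \<nu> \<longrightarrow> ((\<lambda>t. tv_dist (kpush P t \<nu>) \<mu>) \<longlongrightarrow> 0) at_top)"
proof -
  note merge = merging_tendsto[OF assms]
  have merge_nat: "(\<lambda>n. tv_dist (kpush P (real n) \<mu>) (kpush P (real n) \<nu>)) \<longlonglongrightarrow> 0"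
    if "prob_measure_on \<mu>" "prob_measure_on \<nu>" for \<mu> \<nu>
    using filterlim_compose[OF merge[OF that] filterlim_real_sequentially] .
  obtain h a where ha: "prob_measure_on h" "a > 0"
    "\<And>A. A \<in> sets borel \<Longrightarrow> \<forall>\<^sub>F n in sequentially. a * measure h A \<le> measure (P (real n) z) A + a / 2"
    using ex_lower_bound[OF assms] by blast
  obtain \<mu> where \<mu>: "prob_measure_on \<mu>" "kpush P 1 \<mu> = \<mu>"
  proof (rule ex_invariant_of_lower_bound[OF ha(1,2,3)])
    fix A :: "'a set" assume A: "A \<in> sets borel"
    \<comment> \<open>The law at time \<open>n + 1\<close> is the image of \<open>P 1 z\<close>
      after time \<open>n\<close>, so consecutive laws merge like the initial distributions
      \<open>P 1 z\<close> and the point mass at \<open>z\<close>.\<close>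
    have le: "\<bar>measure (P (real n + 1) z) A - measure (P (real n) z) A\<bar>
        \<le> tv_dist (kpush P (real n) (P 1 z)) (kpush P (real n) (return borel z))" for n
      using measure_diff_le_tv_dist[OF prob_measure_on_kernel prob_measure_on_kernel A, of "real n + 1" "real n" z z]
      by (simp add: kpush_kernel kpush_return add.commute)
    show "(\<lambda>n. measure (P (real n + 1) z) A - measure (P (real n) z) A) \<longlonglongrightarrow> 0"
      by (rule Lim_null_comparison[OF always_eventually])
        (use merge_nat[OF prob_measure_on_kernel prob_measure_on_return, of 1 z z] le in auto)
  qed
  \<comment> \<open>Invariance under the single kernel \<open>P 1\<close> already forces uniqueness.
    This yields invariance at all times: \<open>kpush P t \<mu>\<close> is again invariant under
    \<open>P 1\<close>, as the kernels commute, and so equals \<open>\<mu>\<close>.\<close>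
  have unique: "\<kappa> = \<nu>" if \<kappa>: "prob_measure_on \<kappa>" "kpush P 1 \<kappa> = \<kappa>" and \<nu>: "prob_measure_on \<nu>" "kpush P 1 \<nu> = \<nu>" for \<kappa> \<nu>
  proof -
    have iter: "kpush P (real n) \<rho> = \<rho>" if "prob_measure_on \<rho>" "kpush P 1 \<rho> = \<rho>" for \<rho> n
    proof (induction n)
      case 0
      have "P 0 = return borel" using feller by (auto simp: feller_markov_semigroup_def)
      then show ?case using prob_measure_onD(2)[OF that(1)] by (simp add: kpush_def bind_return'')
    next
      case (Suc n)
      then show ?case using kpush_add[of 1 "real n" \<rho>] that by (simp add: add.commute)
    qed
    have "tv_dist \<kappa> \<nu> = 0"
      using merge_nat[OF \<kappa>(1) \<nu>(1)] iter \<kappa> \<nu> by (simp add: LIMSEQ_const_iff)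
    then show ?thesis by (rule tv_dist_eq_0D[OF \<kappa>(1) \<nu>(1)])
  qed
  have inv: "invariant_measure P \<mu>"
    unfolding invariant_measure_def
  proof (intro conjI allI impI \<mu>(1))
    fix t :: real assume t: "t \<ge> 0"
    have "kpush P 1 (kpush P t \<mu>) = kpush P t (kpush P 1 \<mu>)"
      using kpush_add[OF t _ \<mu>(1), of 1] kpush_add[OF _ t \<mu>(1), of 1] by (simp add: add.commute)
    then show "kpush P t \<mu> = \<mu>"
      using unique[OF prob_measure_on_kpush[OF t \<mu>(1)] _ \<mu>] \<mu>(2) by simp
  qed
  show ?thesis
  proof (intro exI[of _ \<mu>] conjI allI impI inv)
    show "\<mu>' = \<mu>" if "invariant_measure P \<mu>'" for \<mu>'
      using unique[OF _ _ \<mu>, of \<mu>'] that by (simp add: invariant_measure_def)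
    fix \<nu> :: "'a measure" assume \<nu>: "prob_measure_on \<nu>"
    have "\<forall>\<^sub>F t in at_top. tv_dist (kpush P t \<nu>) (kpush P t \<mu>) = tv_dist (kpush P t \<nu>) \<mu>"
      using eventually_ge_at_top[of 0] by eventually_elim (use inv in \<open>auto simp: invariant_measure_def\<close>)
    with merge[OF \<nu> \<mu>(1)] show "((\<lambda>t. tv_dist (kpush P t \<nu>) \<mu>) \<longlongrightarrow> 0) at_top"
      by (rule Lim_transform_eventually)
  qed
qed

section \<open>The converse: continuity and \<open>C1\<close> from convergence\<close>

lemma uec_of_convergence:
  assumes \<mu>: "prob_measure_on \<mu>"
    and conv: "\<And>x. ((\<lambda>t. tv_dist (P t x) \<mu>) \<longlongrightarrow> 0) at_top"
  shows "uec_at P unit_ball_fns x"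
proof -
  \<comment> \<open>Both laws converge to \<open>\<mu>\<close>, so the triangle inequality makes the
    inner upper limit zero for every \<open>x'\<close>, near \<open>x\<close> or not.\<close>
  have "Limsup at_top (\<lambda>t. SUP f\<in>unit_ball_fns. ereal \<bar>trans_op P t f x' - trans_op P t f x\<bar>) = 0" for x'
  proof (rule lim_imp_Limsup)
    have "((\<lambda>t. tv_dist (P t x') \<mu> + tv_dist (P t x) \<mu>) \<longlongrightarrow> 0) at_top"
      using tendsto_add[OF conv[of x'] conv[of x]] by simp
    then have upper: "((\<lambda>t. ereal (tv_dist (P t x') \<mu> + tv_dist (P t x) \<mu>)) \<longlongrightarrow> 0) at_top"
      by (simp add: zero_ereal_def)
    show "((\<lambda>t. SUP f\<in>unit_ball_fns. ereal \<bar>trans_op P t f x' - trans_op P t f x\<bar>) \<longlongrightarrow> 0) at_top"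
    proof (rule tendsto_sandwich[OF _ _ tendsto_const upper])
      show "\<forall>\<^sub>F t in at_top. 0 \<le> (SUP f\<in>unit_ball_fns. ereal \<bar>trans_op P t f x' - trans_op P t f x\<bar>)"
        by (intro always_eventually allI SUP_upper2[OF zero_in_unit_ball_fns]) simp
      show "\<forall>\<^sub>F t in at_top. (SUP f\<in>unit_ball_fns. ereal \<bar>trans_op P t f x' - trans_op P t f x\<bar>)
          \<le> ereal (tv_dist (P t x') \<mu> + tv_dist (P t x) \<mu>)"
        using eventually_ge_at_top[of 0]
      proof eventually_elim
        case (elim t)
        show ?case
        proof (rule SUP_least)
          fix f :: "'a \<Rightarrow> real" assume f: "f \<in> unit_ball_fns"
          show "ereal \<bar>trans_op P t f x' - trans_op P t f x\<bar> \<le> ereal (tv_dist (P t x') \<mu> + tv_dist (P t x) \<mu>)"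
            using diff_le_tv_dist[OF prob_measure_on_kernel[OF elim] \<mu> f, of x]
              diff_le_tv_dist[OF prob_measure_on_kernel[OF elim] \<mu> f, of x']
            by (simp add: trans_op_def)
        qed
      qed
    qed
  qed simp
  then show ?thesis by (simp add: uec_at_def Limsup_const)
qed

text \<open>Any \<open>z\<close> in the support of \<open>\<mu>\<close> works; if there were none,
  the whole space would be null. The lower limit is then the \<open>\<mu>\<close>-mass of the ball
  for every starting point.\<close>

lemma C1_of_convergence:
  assumes \<mu>: "prob_measure_on \<mu>"
    and conv: "\<And>x. ((\<lambda>t. tv_dist (P t x) \<mu>) \<longlongrightarrow> 0) at_top"
  shows "\<exists>z. C1_at P z"
proof -
  interpret prob_space \<mu> using prob_measure_onD[OF \<mu>] by simp
  have "measure \<mu> UNIV = 1" using prob_space prob_measure_onD(3)[OF \<mu>] by simp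
  then obtain z where z: "\<And>r. r > 0 \<Longrightarrow> measure \<mu> (ball z r) \<noteq> 0"
    using measure_eq_0_if_locally_null[OF \<mu>, of UNIV] by auto
  have "Liminf at_top (\<lambda>t. ereal (measure (P t x) (ball z r))) = ereal (measure \<mu> (ball z r))" for x r
  proof (rule lim_imp_Liminf)
    have "((\<lambda>t. measure (P t x) (ball z r) - measure \<mu> (ball z r)) \<longlongrightarrow> 0) at_top"
    proof (rule Lim_null_comparison[OF _ conv[of x]])
      show "\<forall>\<^sub>F t in at_top. norm (measure (P t x) (ball z r) - measure \<mu> (ball z r)) \<le> tv_dist (P t x) \<mu>"
        using eventually_ge_at_top[of 0]
        by eventually_elim (simp add: measure_diff_le_tv_dist prob_measure_on_kernel \<mu>)
    qed
    then show "((\<lambda>t. ereal (measure (P t x) (ball z r))) \<longlongrightarrow> ereal (measure \<mu> (ball z r))) at_top"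
      by (simp add: LIM_zero_cancel)
  qed simp
  then have "C1_at P z" using z by (simp add: C1_at_def zero_less_measure_iff)
  then show ?thesis by blast
qed

end

theorem mainTheorem7:
  fixes P :: "real \<Rightarrow> 'a::polish_space \<Rightarrow> 'a measure"
  assumes "feller_markov_semigroup P"
  shows "((\<exists>\<mu>. invariant_measure P \<mu> \<and> (\<forall>\<mu>'. invariant_measure P \<mu>' \<longrightarrow> \<mu>' = \<mu>) \<and>
              (\<forall>\<nu>. prob_measure_on \<nu> \<longrightarrow> ((\<lambda>t. tv_dist (kpush P t \<nu>) \<mu>) \<longlongrightarrow> 0) at_top))
          \<longleftrightarrow> ((\<forall>x. uec_at P unit_ball_fns x) \<and> (\<exists>z. C1_at P z)))
       \<and> (((\<forall>x. uec_at P unit_ball_fns x) \<and> (\<exists>z. C1_at P z))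
          \<longleftrightarrow> (\<exists>z. uec_at P unit_ball_fns z \<and> C1_at P z))"
    (is "(?i \<longleftrightarrow> ?ii) \<and> (?ii \<longleftrightarrow> ?iii)")
proof -
  interpret feller_semigroup P by standard fact
  have i_ii: "?ii" if i: "?i"
  proof -
    obtain \<mu> where \<mu>: "prob_measure_on \<mu>"
      and conv: "\<And>\<nu>. prob_measure_on \<nu> \<Longrightarrow> ((\<lambda>t. tv_dist (kpush P t \<nu>) \<mu>) \<longlongrightarrow> 0) at_top"
      using i by (auto simp: invariant_measure_def)
    \<comment> \<open>Point masses are initial distributions whose images are the kernels
      themselves; the converse lemmas use convergence for these only.\<close>
    have "((\<lambda>t. tv_dist (P t x) \<mu>) \<longlongrightarrow> 0) at_top" for x
    proof (rule Lim_transform_eventually[OF conv[OF prob_measure_on_return[of x]]])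
      show "\<forall>\<^sub>F t in at_top. tv_dist (kpush P t (return borel x)) \<mu> = tv_dist (P t x) \<mu>"
        using eventually_ge_at_top[of 0] by eventually_elim (simp add: kpush_return)
    qed
    then show ?ii using uec_of_convergence[OF \<mu>] C1_of_convergence[OF \<mu>] by blast
  qed
  have iii_i: "?i" if iii: "?iii"
  proof -
    from iii obtain z where "uec_at P unit_ball_fns z" "C1_at P z" by blast
    then show ?i by (rule convergence_of_uec_C1)
  qed
  have ii_iii: "?iii" if ii: "?ii" using ii by blast
  show ?thesis
  proof (rule conjI)
    show "?i \<longleftrightarrow> ?ii" by (rule iffI[OF i_ii iii_i[OF ii_iii]])
    show "?ii \<longleftrightarrow> ?iii" by (rule iffI[OF ii_iii i_ii[OF iii_i]])
  qed
qed

end
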